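(* Let $G$ be a $K_{2,3}$-minor free graph of order $n\geq 22$. Then $q(G)\leq q(F_{2,3}(n))$, with equality if and only if $G=F_{2,3}(n)$. Here, writing $n-1=3p+r$ with integers $p\ge 0$ and $0\le r<3$, $q(F_{2,3}(n))$ is the largest root of the equation $$x^3-(n+2r+3)x^2+(8r+3n+2rn-8)x+14r+4n-8rn-2r^2-4=0.$$
   Context: All graphs are finite, simple and undirected. For a graph $G$, $Q(G)=D(G)+A(G)$ is the signless Laplacian matrix ($D(G)$ the diagonal degree matrix, $A(G)$ the adjacency matrix), and $q(G)$ denotes its largest eigenvalue (the signless Laplacian spectral radius). A graph $H$ is a minor of $G$ if $H$ can be obtained from $G$ by deleting edges, contracting edges, or deleting vertices; $G$ is $H$-minor free if it has no minor isomorphic to $H$. $K_{s,t}$ is the complete bipartite graph with parts of sizes $s$ and $t$, and $K_m$ the complete graph on $m$ vertices. For graphs $G,H$ on disjoint vertex sets, $G\cup H$ is their disjoint union, $G\vee H$ is their join (disjoint union plus all edges between $V(G)$ and $V(H)$), and $k\cdot G$ is the disjoint union of $k$ copies of $G$. For $2\le s\le t$ and $n\ge s-1$, write $n-s+1=pt+r$ with $0\le r<t$, and set $F_{s,t}(n):=K_{s-1}\vee(p\cdot K_t\cup K_r)$ (where $K_0$ is the empty graph). *)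

theory Defs
  imports Complex_Main
begin

type_synonym 'a graph = "'a set \<times> 'a set set"

definition verts :: "'a graph \<Rightarrow> 'a set" where "verts G = fst G"
definition edges :: "'a graph \<Rightarrow> 'a set set" where "edges G = snd G"

definition simple_graph :: "'a graph \<Rightarrow> bool" where
  "simple_graph G \<longleftrightarrow> finite (verts G) \<and>
     (\<forall>e\<in>edges G. \<exists>u v. u \<noteq> v \<and> u \<in> verts G \<and> v \<in> verts G \<and> e = {u, v})"

definition adj :: "'a graph \<Rightarrow> 'a \<Rightarrow> 'a \<Rightarrow> bool" where
  "adj G u v \<longleftrightarrow> {u, v} \<in> edges G \<and> u \<noteq> v"

definition degree :: "'a graph \<Rightarrow> 'a \<Rightarrow> nat" where
  "degree G v = card {u \<in> verts G. adj G v u}"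

definition isomorphic :: "'a graph \<Rightarrow> 'b graph \<Rightarrow> bool" where
  "isomorphic G H \<longleftrightarrow> (\<exists>f. bij_betw f (verts G) (verts H) \<and>
     (\<forall>u\<in>verts G. \<forall>v\<in>verts G. adj G u v \<longleftrightarrow> adj H (f u) (f v)))"

definition minor_step :: "'a graph \<Rightarrow> 'a graph \<Rightarrow> bool" where
  "minor_step G H \<longleftrightarrow>
     (\<exists>e\<in>edges G. H = (verts G, edges G - {e})) \<or>
     (\<exists>v\<in>verts G. H = (verts G - {v}, {e\<in>edges G. v \<notin> e})) \<or>
     (\<exists>u v. {u, v} \<in> edges G \<and> u \<noteq> v \<and>
        H = (verts G - {v}, {e\<in>edges G. v \<notin> e} \<union> {{u, w} | w. {v, w} \<in> edges G \<and> w \<noteq> u}))"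

definition is_minor :: "'b graph \<Rightarrow> 'a graph \<Rightarrow> bool" where
  "is_minor H G \<longleftrightarrow> (\<exists>G'. minor_step\<^sup>*\<^sup>* G G' \<and> isomorphic G' H)"

definition minor_free :: "'b graph \<Rightarrow> 'a graph \<Rightarrow> bool" where
  "minor_free H G \<longleftrightarrow> \<not> is_minor H G"

definition signless_laplacian :: "'a graph \<Rightarrow> ('a \<Rightarrow> real) \<Rightarrow> 'a \<Rightarrow> real" where
  "signless_laplacian G x v = real (degree G v) * x v + (\<Sum>u\<in>{u \<in> verts G. adj G v u}. x u)"

definition Q_eigenvalue :: "'a graph \<Rightarrow> real \<Rightarrow> bool" where
  "Q_eigenvalue G lam \<longleftrightarrow> (\<exists>x. (\<forall>v. v \<notin> verts G \<longrightarrow> x v = 0) \<and> (\<exists>v\<in>verts G. x v \<noteq> 0) \<and>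
      (\<forall>v\<in>verts G. signless_laplacian G x v = lam * x v))"

text \<open>q(G): the largest eigenvalue of Q(G) (Q(G) is real symmetric, so all eigenvalues are real).\<close>
definition q :: "'a graph \<Rightarrow> real" where
  "q G = Max {lam. Q_eigenvalue G lam}"

definition K_bip :: "nat \<Rightarrow> nat \<Rightarrow> nat graph" where
  "K_bip s t = ({0..<s+t}, {{i, j} | i j. i < s \<and> s \<le> j \<and> j < s + t})"

text \<open>F_{s,t}(n) = K_{s-1} \<or> (p K_t \<union> K_r) where n - s + 1 = p t + r, on vertices {0..<n}:
  vertices 0..s-2 form the K_{s-1}; vertex i \<ge> s-1 lies in block (i-(s-1)) div t.\<close>
definition F_graph :: "nat \<Rightarrow> nat \<Rightarrow> nat \<Rightarrow> nat graph" where
  "F_graph s t n = ({0..<n}, {{i, j} | i j. i < n \<and> j < n \<and> i \<noteq> j \<and>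
      (i < s - 1 \<or> j < s - 1 \<or> (i - (s - 1)) div t = (j - (s - 1)) div t)})"

end

theory Submission
  imports Defs "Jordan_Normal_Form.Spectral_Radius"
begin

text \<open>
  By the Collatz--Wielandt bound, \<open>q G \<le> c\<close> as soon as some positive \<open>y\<close> satisfies
  \<open>Q y \<le> c y\<close>. Excluding \<open>K\<^sub>2\<^sub>,\<^sub>3\<close> leaves any two vertices at most two common
  neighbours, and this alone gives \<open>q G \<le> n < q F\<close> when there is no vertex of degree
  \<open>n - 1\<close>: take \<open>y\<close> to be the degree vector if all degrees are at most \<open>n - 4\<close>, and
  otherwise weight 1 at a vertex of maximum degree and \<open>2 / n\<close> elsewhere.

  If \<open>v\<close> is adjacent to everything, then \<open>G - v\<close> has maximum degree at most 2, and contracting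
  edges of a wheel shows that it has no cycle of length at least 4, so its components are paths and
  triangles. Put weight 1 at \<open>v\<close> and explicit weights on each component such that the rows of
  \<open>Q\<close> outside \<open>v\<close> are bounded by \<open>\<lambda> = q F\<close>. The total weight of a component on \<open>k\<close>
  vertices is at most that of \<open>k\<close> vertices split into triangles and one smaller complete graph;
  the latter quantity is superadditive in \<open>k\<close>, which bounds the row of \<open>v\<close>, strictly unless
  \<open>G\<close> is \<open>F\<close>.
\<close>

section \<open>Graphs and minors\<close>

lemma simple_graph_edgeD:
  assumes "simple_graph G" "{u, v} \<in> edges G"
  shows "u \<noteq> v" "u \<in> verts G" "v \<in> verts G"
proof -
  obtain a b where "a \<noteq> b" "a \<in> verts G" "b \<in> verts G" "{u, v} = {a, b}"
    using assms unfolding simple_graph_def by meson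
  then show "u \<noteq> v" "u \<in> verts G" "v \<in> verts G" by (auto simp: doubleton_eq_iff)
qed

lemma simple_graph_finite_edges: "simple_graph G \<Longrightarrow> finite (edges G)"
  unfolding simple_graph_def by (rule finite_subset[of _ "Pow (verts G)"]) auto

lemma adj_sym: "adj G u v \<longleftrightarrow> adj G v u"
  by (auto simp: adj_def insert_commute)

lemma adj_vertsD: "simple_graph G \<Longrightarrow> adj G u v \<Longrightarrow> u \<in> verts G \<and> v \<in> verts G"
  using simple_graph_edgeD(2,3) by (metis adj_def)

section \<open>Subgraphs as minors\<close>

lemma delete_vertices:
  assumes "finite S" "S \<subseteq> verts G"
  shows "minor_step\<^sup>*\<^sup>* G (verts G - S, {e \<in> edges G. e \<inter> S = {}})"
  using assms
proof (induction S rule: finite_induct)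
  case empty
  then show ?case by (simp add: verts_def edges_def)
next
  case (insert v S)
  let ?H = "(verts G - S, {e \<in> edges G. e \<inter> S = {}})"
  have "minor_step ?H (verts G - insert v S, {e \<in> edges G. e \<inter> insert v S = {}})"
    unfolding minor_step_def
    by (rule disjI2, rule disjI1, rule bexI[of _ v]) (use insert in \<open>auto simp: verts_def edges_def\<close>)
  with insert show ?case by (meson insert_subset rtranclp.rtrancl_into_rtrancl)
qed

lemma delete_edges:
  assumes "finite T" "T \<subseteq> edges G"
  shows "minor_step\<^sup>*\<^sup>* G (verts G, edges G - T)"
  using assms
proof (induction T rule: finite_induct)
  case empty
  then show ?case by (simp add: verts_def edges_def)
next
  case (insert e T)
  have "minor_step (verts G, edges G - T) (verts G, edges G - insert e T)"
    unfolding minor_step_def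
    by (rule disjI1, rule bexI[of _ e]) (use insert in \<open>auto simp: verts_def edges_def\<close>)
  with insert show ?case by (meson insert_subset rtranclp.rtrancl_into_rtrancl)
qed

lemma subgraph_minor_steps:
  assumes G: "simple_graph G" and X: "X \<subseteq> verts G" and E: "E \<subseteq> edges G" "\<And>e. e \<in> E \<Longrightarrow> e \<subseteq> X"
  shows "minor_step\<^sup>*\<^sup>* G (X, E)"
proof -
  let ?S = "verts G - X"
  let ?H = "(verts G - ?S, {e \<in> edges G. e \<inter> ?S = {}})"
  have "finite (verts G)" using G by (simp add: simple_graph_def)
  then have 1: "minor_step\<^sup>*\<^sup>* G ?H" by (intro delete_vertices) auto
  have "finite (edges ?H)" using simple_graph_finite_edges[OF G] by (simp add: edges_def)
  then have 2: "minor_step\<^sup>*\<^sup>* ?H (verts ?H, edges ?H - (edges ?H - E))"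
    by (intro delete_edges) auto
  have "verts ?H = X" using X by (auto simp: verts_def)
  moreover have "edges ?H - (edges ?H - E) = E" using E by (auto simp: edges_def)
  ultimately have "minor_step\<^sup>*\<^sup>* ?H (X, E)" using 2 by simp
  with 1 show ?thesis by (rule rtranclp_trans)
qed

lemma embedding_is_minor:
  assumes G: "simple_graph G" and H: "simple_graph H"
    and g: "inj_on g (verts H)" "g ` verts H \<subseteq> verts G"
    and e: "\<And>u v. adj H u v \<Longrightarrow> adj G (g u) (g v)"
  shows "is_minor H G"
proof -
  \<comment> \<open>Only images of edges of H are kept: g need not reflect adjacency, so any further
    edges of G between image vertices must be deleted.\<close>
  let ?E = "{{g u, g v} | u v. adj H u v}"
  let ?G = "(g ` verts H, ?E)"
  have "minor_step\<^sup>*\<^sup>* G ?G"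
  proof (rule subgraph_minor_steps[OF G g(2)])
    show "?E \<subseteq> edges G" using e by (auto simp: adj_def)
    show "\<And>x. x \<in> ?E \<Longrightarrow> x \<subseteq> g ` verts H" using adj_vertsD[OF H] by auto
  qed
  moreover have "isomorphic ?G H"
    unfolding isomorphic_def
  proof (intro exI[of _ "inv_into (verts H) g"] conjI ballI)
    show "bij_betw (inv_into (verts H) g) (verts ?G) (verts H)"
      using g(1) by (simp add: bij_betw_inv_into inj_on_imp_bij_betw verts_def)
    fix x y assume "x \<in> verts ?G" "y \<in> verts ?G"
    then obtain u v where uv: "x = g u" "y = g v" "u \<in> verts H" "v \<in> verts H"
      by (auto simp: verts_def)
    have "{g u, g v} \<in> ?E \<longleftrightarrow> adj H u v"
    proof
      assume "{g u, g v} \<in> ?E"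
      then obtain u' v' where "{g u, g v} = {g u', g v'}" "adj H u' v'" by auto
      then show "adj H u v"
        using g(1) uv adj_vertsD[OF H] by (metis adj_sym doubleton_eq_iff inj_onD)
    qed auto
    moreover have "adj H u v \<Longrightarrow> g u \<noteq> g v"
      using e by (auto simp: adj_def)
    ultimately have "adj ?G (g u) (g v) \<longleftrightarrow> adj H u v" by (auto simp: adj_def edges_def)
    then show "adj ?G x y \<longleftrightarrow> adj H (inv_into (verts H) g x) (inv_into (verts H) g y)"
      using uv g(1) by simp
  qed
  ultimately show ?thesis unfolding is_minor_def by blast
qed

lemma verts_K_bip: "verts (K_bip s t) = {0..<s+t}"
  by (simp add: verts_def K_bip_def)

lemma adj_K_bip: "adj (K_bip s t) u v \<longleftrightarrow>
    u < s \<and> s \<le> v \<and> v < s + t \<or> v < s \<and> s \<le> u \<and> u < s + t"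
  by (auto simp: adj_def edges_def K_bip_def doubleton_eq_iff)

lemma simple_graph_K_bip: "simple_graph (K_bip s t)"
  unfolding simple_graph_def 
proof (intro conjI ballI)
  fix e assume "e \<in> edges (K_bip s t)"
  then obtain i j where "e = {i, j}" "i < s" "s \<le> j" "j < s + t"
    by (auto simp: edges_def K_bip_def)
  then show "\<exists>u v. u \<noteq> v \<and> u \<in> verts (K_bip s t) \<and> v \<in> verts (K_bip s t) \<and> e = {u, v}"
    by (intro exI[of _ i] exI[of _ j]) (simp add: verts_K_bip)
qed (simp add: verts_K_bip)

section \<open>Common neighbours and wheels as sources of \<open>K_bip 2 3\<close> minors\<close>

lemma K23_minor_of_common_neighbours:
  assumes G: "simple_graph G" and "u \<noteq> w" and dist: "distinct [a, b, c]"
    and u: "adj G u a" "adj G u b" "adj G u c" and w: "adj G w a" "adj G w b" "adj G w c"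
  shows "is_minor (K_bip 2 3) G"
proof (rule embedding_is_minor[OF G simple_graph_K_bip, where g = "(!) [u, w, a, b, c]"])
  \<comment> \<open>That u and w differ from a, b, c comes from irreflexivity of
    \<open>adj\<close>.\<close>
  have "distinct [u, w, a, b, c]" using assms by (auto simp: adj_def)
  then show "inj_on ((!) [u, w, a, b, c]) (verts (K_bip 2 3))"
    unfolding verts_K_bip by (intro inj_on_nth) auto
  show "(!) [u, w, a, b, c] ` verts (K_bip 2 3) \<subseteq> verts G"
    using u w adj_vertsD[OF G] by (auto simp: verts_K_bip less_Suc_eq numeral_eq_Suc)
  fix i j assume ij: "adj (K_bip 2 3) i j"
  have *: "adj G ([u, w, a, b, c] ! i) ([u, w, a, b, c] ! j)" if "i < 2" "2 \<le> j" "j < 5" for i j :: nat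
  proof -
    have "i \<in> {0, 1}" "j \<in> {2, 3, 4}" using that by auto
    then show ?thesis using u w by auto
  qed
  consider "i < 2" "2 \<le> j" "j < 5" | "j < 2" "2 \<le> i" "i < 5"
    using ij unfolding adj_K_bip by auto
  then show "adj G ([u, w, a, b, c] ! i) ([u, w, a, b, c] ! j)"
    by cases (metis * adj_sym)+
qed

lemma card_common_neighbours_le:
  assumes G: "simple_graph G" and mf: "minor_free (K_bip 2 3) G" and "u \<noteq> w"
  shows "card {x \<in> verts G. adj G u x \<and> adj G w x} \<le> 2"
proof (rule ccontr)
  assume "\<not> ?thesis"
  then have "3 \<le> card {x \<in> verts G. adj G u x \<and> adj G w x}" by simp
  then obtain T where T: "T \<subseteq> {x \<in> verts G. adj G u x \<and> adj G w x}" "card T = 3"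
    by (rule obtain_subset_with_card_n)
  then obtain a b c where "T = {a, b, c}" "a \<noteq> b" "b \<noteq> c" "a \<noteq> c" unfolding card_3_iff by blast
  then have "is_minor (K_bip 2 3) G"
    using K23_minor_of_common_neighbours[OF G \<open>u \<noteq> w\<close>, of a b c] T(1) by auto
  with mf show False by (simp add: minor_free_def)
qed

text \<open>Induction on the rim length. On a rim x, y, z, w the opposite vertices x and z have the
  three common neighbours y, w and the hub. A longer rim is shortened by contracting its edge xy,
  which changes the graph, so G is generalised as well.\<close>

lemma wheel_K23_minor:
  assumes "simple_graph G" "distinct cs" "4 \<le> length cs" "h \<notin> set cs"
    "\<And>c. c \<in> set cs \<Longrightarrow> adj G h c" "successively (adj G) cs" "adj G (last cs) (hd cs)"
  shows "is_minor (K_bip 2 3) G"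
  using assms
proof (induction "length cs" arbitrary: cs G rule: less_induct)
  case less
  obtain x y z w zs where cs: "cs = x # y # z # w # zs"
    using less.prems(3) by (auto simp: numeral_eq_Suc Suc_le_length_iff)
  show ?case
  proof (cases zs)
    case Nil
    then show ?thesis
      using K23_minor_of_common_neighbours[of G x z y w h] less.prems cs adj_sym[of G]
      by (auto simp: successively.simps)
  next
    case (Cons)
    \<comment> \<open>y is merged into x: the rim edge yz becomes xz, which closes the shorter rim
      \<open>?ds\<close>.\<close>
    let ?H = "(verts G - {y}, {e \<in> edges G. y \<notin> e} \<union> {{x, v} | v. {y, v} \<in> edges G \<and> v \<noteq> x})"
    let ?ds = "x # z # w # zs"
    note sg = less.prems(1)
    have xy: "adj G x y" "adj G y z" using less.prems(6) cs by (auto simp: successively.simps)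
    have H: "simple_graph ?H"
      unfolding simple_graph_def
    proof (intro conjI ballI)
      show "finite (verts ?H)" using sg by (simp add: simple_graph_def verts_def)
      fix e assume "e \<in> edges ?H"
      then consider "e \<in> edges G" "y \<notin> e" | v where "e = {x, v}" "{y, v} \<in> edges G" "v \<noteq> x"
        by (auto simp: edges_def)
      then show "\<exists>u v. u \<noteq> v \<and> u \<in> verts ?H \<and> v \<in> verts ?H \<and> e = {u, v}"
      proof cases
        case 1
        then obtain u v where "u \<noteq> v" "u \<in> verts G" "v \<in> verts G" "e = {u, v}"
          using sg unfolding simple_graph_def by meson
        with 1 show ?thesis by (auto simp: verts_def)
      next
        case 2
        have "v \<noteq> y" "v \<in> verts G" using simple_graph_edgeD[OF sg 2(2)] by auto
        moreover have "x \<noteq> y" "x \<in> verts G" using adj_vertsD[OF sg xy(1)] xy(1) by (auto simp: adj_def)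
        ultimately show ?thesis using 2 by (auto simp: verts_def)
      qed
    qed
    have old: "adj ?H u v" if "adj G u v" "u \<noteq> y" "v \<noteq> y" for u v
      using that by (auto simp: adj_def edges_def)
    have xz: "adj ?H x z"
      using xy less.prems(2) cs by (auto simp: adj_def edges_def)
    have "is_minor (K_bip 2 3) ?H"
    proof (rule less.hyps[OF _ H, of ?ds])
      have "successively (adj ?H) (z # w # zs)"
      proof (rule successively_mono[of "adj G"])
        show "successively (adj G) (z # w # zs)" using less.prems(6) cs by simp
        show "\<And>u v. u \<in> set (z # w # zs) \<Longrightarrow> v \<in> set (z # w # zs) \<Longrightarrow> adj G u v \<Longrightarrow> adj ?H u v"
          using less.prems(2) cs by (intro old) auto
      qed
      with xz show "successively (adj ?H) ?ds" by simp
      show "adj ?H (last ?ds) (hd ?ds)"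
        using less.prems(2,7) cs last_in_set[of "z # w # zs"] by (intro old) auto
      show "\<And>c. c \<in> set ?ds \<Longrightarrow> adj ?H h c"
        using less.prems(2,4,5) cs by (intro old) auto
    qed (use less.prems cs Cons in auto)
    moreover have "minor_step G ?H"
      unfolding minor_step_def
      by (rule disjI2, rule disjI2, rule exI[of _ x], rule exI[of _ y]) (use xy in \<open>auto simp: adj_def\<close>)
    ultimately show ?thesis
      unfolding is_minor_def by (meson converse_rtranclp_into_rtranclp)
  qed
qed

section \<open>Eigenvalues of the signless Laplacian\<close>

text \<open>Rows and columns are indexed by V itself. The field is arbitrary because a real matrix
  is also viewed as a complex one.\<close>

definition fun_eigenvalue :: "'a set \<Rightarrow> ('a \<Rightarrow> 'a \<Rightarrow> 'c :: field) \<Rightarrow> 'c \<Rightarrow> bool" where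
  "fun_eigenvalue V M k \<longleftrightarrow>
     (\<exists>x. (\<exists>v\<in>V. x v \<noteq> 0) \<and> (\<forall>v\<in>V. (\<Sum>w\<in>V. M v w * x w) = k * x v))"

lemma eigenvalue_mat_iff:
  fixes M :: "'a \<Rightarrow> 'a \<Rightarrow> 'c :: field"
  assumes f: "bij_betw f {0..<n} V"
  shows "eigenvalue (mat n n (\<lambda>(i, j). M (f i) (f j))) k \<longleftrightarrow> fun_eigenvalue V M k"
proof
  let ?A = "mat n n (\<lambda>(i, j). M (f i) (f j))"
  define g where "g = inv_into {0..<n} f"
  have g: "g v < n" "f (g v) = v" if "v \<in> V" for v
    using f that bij_betw_apply[OF bij_betw_inv_into[OF f]] unfolding g_def
    by (auto simp: bij_betw_inv_into_right)
  have gf: "g (f i) = i" if "i < n" for i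
    using f that unfolding g_def by (simp add: bij_betw_inv_into_left)
  have fV: "f i \<in> V" if "i < n" for i
    using f that by (auto simp: bij_betw_def)
  have sum: "(\<Sum>w\<in>V. h w) = (\<Sum>j\<in>{0..<n}. h (f j))" for h :: "'a \<Rightarrow> 'c"
    by (rule sum.reindex_bij_betw[OF f, symmetric])
  {
    assume "eigenvalue ?A k"
    then obtain x where x: "x \<in> carrier_vec n" "x \<noteq> 0\<^sub>v n" "?A *\<^sub>v x = k \<cdot>\<^sub>v x"
      unfolding eigenvalue_def eigenvector_def by auto
    have "\<exists>i<n. x $ i \<noteq> 0"
      using x(1,2) by (metis carrier_vecD eq_vecI index_zero_vec(1) zero_carrier_vec)
    then obtain i where i: "i < n" "x $ i \<noteq> 0" by blast
    have row: "(\<Sum>w\<in>V. M v w * x $ g w) = k * x $ g v" if "v \<in> V" for v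
    proof -
      have "(?A *\<^sub>v x) $ g v = (k \<cdot>\<^sub>v x) $ g v" using x(3) by simp
      then show ?thesis
        using x(1) g[OF that] gf unfolding sum by (simp add: scalar_prod_def)
    qed
    show "fun_eigenvalue V M k"
      unfolding fun_eigenvalue_def
      by (rule exI[of _ "\<lambda>v. x $ g v"]) (use i row fV[of i] gf[of i] in \<open>auto intro!: bexI[of _ "f i"]\<close>)
  }
  {
    assume "fun_eigenvalue V M k"
    then obtain x v where x: "v \<in> V" "x v \<noteq> 0" "\<And>v. v \<in> V \<Longrightarrow> (\<Sum>w\<in>V. M v w * x w) = k * x v"
      unfolding fun_eigenvalue_def by blast
    let ?x = "vec n (\<lambda>i. x (f i))"
    have "?A *\<^sub>v ?x = k \<cdot>\<^sub>v ?x"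
    proof (rule eq_vecI)
      fix i assume "i < dim_vec (k \<cdot>\<^sub>v ?x)"
      then show "(?A *\<^sub>v ?x) $ i = (k \<cdot>\<^sub>v ?x) $ i"
        using x(3)[OF fV, of i] unfolding sum by (simp add: scalar_prod_def)
    qed simp
    moreover have "?x \<noteq> 0\<^sub>v n"
    proof
      assume "?x = 0\<^sub>v n"
      then have "?x $ g v = 0" using g[OF x(1)] by simp
      with g[OF x(1)] x(2) show False by simp
    qed
    ultimately show "eigenvalue ?A k"
      unfolding eigenvalue_def eigenvector_def by (intro exI[of _ ?x]) simp
  }
qed

lemma finite_fun_eigenvalues:
  fixes M :: "'a \<Rightarrow> 'a \<Rightarrow> 'c :: field"
  assumes "finite V"
  shows "finite {k. fun_eigenvalue V M k}"
proof -
  obtain f where f: "bij_betw f {0..<card V} V"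
    using ex_bij_betw_nat_finite[OF assms] by blast
  let ?A = "mat (card V) (card V) (\<lambda>(i, j). M (f i) (f j))"
  have "spectrum ?A = {k. fun_eigenvalue V M k}"
    by (auto simp: spectrum_def eigenvalue_mat_iff[OF f])
  then show ?thesis using card_finite_spectrum(1)[of ?A "card V"] by simp
qed

text \<open>Over the complex numbers an eigenvalue k with eigenvector x exists. Symmetry makes the
  Hermitian form s of x real, and s is k times the squared norm of x, so k is real. The real or the
  imaginary part of x is then a real eigenvector.\<close>

lemma symmetric_real_fun_eigenvalue_exists:
  fixes M :: "'a \<Rightarrow> 'a \<Rightarrow> real"
  assumes V: "finite V" "V \<noteq> {}" and sym: "\<And>v w. M v w = M w v"
  shows "\<exists>k. fun_eigenvalue V M k"
proof -
  obtain f where f: "bij_betw f {0..<card V} V"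
    using ex_bij_betw_nat_finite[OF V(1)] by blast
  define C where "C = (\<lambda>v w. complex_of_real (M v w))"
  have "spectrum (mat (card V) (card V) (\<lambda>(i, j). C (f i) (f j))) \<noteq> {}"
    using V by (intro spectrum_non_empty[of _ "card V"]) (auto simp: card_gt_0_iff)
  then obtain k where "fun_eigenvalue V C k"
    by (auto simp: spectrum_def eigenvalue_mat_iff[OF f])
  then obtain x u where u: "u \<in> V" "x u \<noteq> 0"
    and x: "\<And>v. v \<in> V \<Longrightarrow> (\<Sum>w\<in>V. C v w * x w) = k * x v"
    unfolding fun_eigenvalue_def by blast
  define s where "s = (\<Sum>v\<in>V. \<Sum>w\<in>V. C v w * (cnj (x v) * x w))"
  define N where "N = (\<Sum>v\<in>V. (cmod (x v))\<^sup>2)"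
  have "s = (\<Sum>v\<in>V. cnj (x v) * (\<Sum>w\<in>V. C v w * x w))"
    unfolding s_def by (simp add: sum_distrib_left mult_ac)
  also have "\<dots> = (\<Sum>v\<in>V. k * complex_of_real ((cmod (x v))\<^sup>2))"
  proof (intro sum.cong refl)
    fix v assume "v \<in> V"
    then show "cnj (x v) * (\<Sum>w\<in>V. C v w * x w) = k * complex_of_real ((cmod (x v))\<^sup>2)"
      unfolding complex_norm_square by (subst x) (simp_all add: mult_ac)
  qed
  finally have s: "s = k * of_real N" by (simp add: N_def sum_distrib_left)
  \<comment> \<open>Conjugation exchanges the roles of v and w; by symmetry, interchanging the two
    sums gives s back.\<close>
  have "cnj s = (\<Sum>v\<in>V. \<Sum>w\<in>V. C w v * (cnj (x w) * x v))"
    unfolding s_def C_def using sym by (simp add: mult_ac)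
  also have "\<dots> = s" unfolding s_def by (rule sum.swap)
  finally have "cnj s = s" .
  moreover have "N > 0"
    unfolding N_def using u V by (intro sum_pos2[of _ u]) auto
  ultimately have "cnj k = k" using s by simp
  then obtain l where l: "k = of_real l" using Reals_cnj_iff Reals_cases by metis
  have re: "(\<Sum>w\<in>V. M v w * Re (x w)) = l * Re (x v)"
    and im: "(\<Sum>w\<in>V. M v w * Im (x w)) = l * Im (x v)" if "v \<in> V" for v
    using arg_cong[OF x[OF that], of Re] arg_cong[OF x[OF that], of Im]
    by (simp_all add: l C_def)
  have "Re (x u) \<noteq> 0 \<or> Im (x u) \<noteq> 0" using u(2) by (simp add: complex_eq_iff)
  then have "fun_eigenvalue V M l"
  proof
    assume "Re (x u) \<noteq> 0"
    with u(1) re show ?thesis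
      unfolding fun_eigenvalue_def by (intro exI[of _ "\<lambda>v. Re (x v)"]) blast
  next
    assume "Im (x u) \<noteq> 0"
    with u(1) im show ?thesis
      unfolding fun_eigenvalue_def by (intro exI[of _ "\<lambda>v. Im (x v)"]) blast
  qed
  then show ?thesis ..
qed

definition Q_entry :: "'a graph \<Rightarrow> 'a \<Rightarrow> 'a \<Rightarrow> real" where
  "Q_entry G v w = (if v = w then real (Defs.degree G v) else 0) + of_bool (adj G v w)"

lemma sum_Q_entry:
  assumes "finite (verts G)" "v \<in> verts G"
  shows "(\<Sum>w\<in>verts G. Q_entry G v w * x w) = signless_laplacian G x v"
proof -
  have "(\<Sum>w\<in>verts G. (if v = w then real (Defs.degree G v) else 0) * x w) = real (Defs.degree G v) * x v"
    using assms by (subst sum.mono_neutral_right[of _ "{v}"]) auto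
  moreover have "(\<Sum>w\<in>verts G. of_bool (adj G v w) * x w) = (\<Sum>w | w \<in> verts G \<and> adj G v w. x w)"
    using assms(1) by (intro sum.mono_neutral_cong_right) auto
  ultimately show ?thesis
    by (simp add: Q_entry_def signless_laplacian_def distrib_right sum.distrib)
qed

lemma signless_laplacian_cong:
  assumes "\<And>w. w \<in> verts G \<Longrightarrow> x w = y w" "v \<in> verts G"
  shows "signless_laplacian G x v = signless_laplacian G y v"
  unfolding signless_laplacian_def using assms by (auto intro!: sum.cong)

lemma Q_eigenvalueI:
  assumes "u \<in> verts G" "x u \<noteq> 0" "\<And>v. v \<in> verts G \<Longrightarrow> signless_laplacian G x v = k * x v"
  shows "Q_eigenvalue G k"
proof -
  \<comment> \<open>\<open>Q_eigenvalue\<close> asks for a vector vanishing outside the vertex set;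
    the rows do not see the values there.\<close>
  let ?y = "\<lambda>v. if v \<in> verts G then x v else 0"
  have "signless_laplacian G ?y v = k * ?y v" if "v \<in> verts G" for v
    using assms(3)[OF that] that signless_laplacian_cong[of G ?y x v] by simp
  then show ?thesis
    unfolding Q_eigenvalue_def using assms(1,2) by (intro exI[of _ ?y]) auto
qed

lemma Q_eigenvalue_iff:
  assumes "finite (verts G)"
  shows "Q_eigenvalue G k \<longleftrightarrow> fun_eigenvalue (verts G) (Q_entry G) k"
proof
  assume "Q_eigenvalue G k"
  then show "fun_eigenvalue (verts G) (Q_entry G) k"
    unfolding Q_eigenvalue_def fun_eigenvalue_def using sum_Q_entry[OF assms] by metis
next
  assume "fun_eigenvalue (verts G) (Q_entry G) k"
  then show "Q_eigenvalue G k"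
    unfolding fun_eigenvalue_def by (metis Q_eigenvalueI sum_Q_entry[OF assms])
qed

lemma finite_Q_eigenvalues: "finite (verts G) \<Longrightarrow> finite {k. Q_eigenvalue G k}"
  by (simp add: Q_eigenvalue_iff finite_fun_eigenvalues)

lemma Q_eigenvalue_q:
  assumes "finite (verts G)" "verts G \<noteq> {}"
  shows "Q_eigenvalue G (q G)"
proof -
  have "Q_entry G v w = Q_entry G w v" for v w
    by (auto simp: Q_entry_def adj_def insert_commute)
  then have "{k. Q_eigenvalue G k} \<noteq> {}"
    using symmetric_real_fun_eigenvalue_exists[OF assms, of "Q_entry G"] assms
    by (simp add: Q_eigenvalue_iff)
  then show ?thesis
    unfolding q_def using Max_in[OF finite_Q_eigenvalues[OF assms(1)]] by simp
qed

lemma Q_eigenvalue_le_q: "finite (verts G) \<Longrightarrow> Q_eigenvalue G k \<Longrightarrow> k \<le> q G"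
  unfolding q_def by (rule Max_ge) (auto simp: finite_Q_eigenvalues)

section \<open>Collatz-Wielandt bounds\<close>

lemma signless_laplacian_alt:
  "signless_laplacian G y v = (\<Sum>w | w \<in> verts G \<and> adj G v w. y v + y w)"
  by (simp add: signless_laplacian_def Defs.degree_def sum.distrib)

text \<open>Collatz--Wielandt: look at the vertex maximising \<open>\<bar>x u\<bar> / y u\<close> for an eigenvector \<open>x\<close>.\<close>
lemma q_row_bound:
  assumes fin: "finite (verts G)" "verts G \<noteq> {}" and y: "\<And>v. v \<in> verts G \<Longrightarrow> 0 < y v"
  shows "\<exists>u\<in>verts G. q G * y u \<le> signless_laplacian G y u"
proof -
  obtain x v where v: "v \<in> verts G" "x v \<noteq> 0"
    and x: "\<And>v. v \<in> verts G \<Longrightarrow> signless_laplacian G x v = q G * x v"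
    using Q_eigenvalue_q[OF fin] unfolding Q_eigenvalue_def by blast
  define R where "R = (\<lambda>u. \<bar>x u\<bar> / y u)"
  define m where "m = Max (R ` verts G)"
  have "m \<in> R ` verts G" unfolding m_def using fin by (intro Max_in) auto
  then obtain u where u: "u \<in> verts G" "R u = m" by blast
  have le: "\<bar>x w\<bar> \<le> m * y w" if "w \<in> verts G" for w
  proof -
    have "R w \<le> m" unfolding m_def using fin that by (intro Max_ge) auto
    then show ?thesis using y[OF that] by (simp add: R_def divide_le_eq)
  qed
  have "0 < \<bar>x v\<bar>" using v(2) by simp
  also have "\<dots> \<le> m * y v" using le v(1) .
  finally have m: "0 < m" using y[OF v(1)] by (simp add: zero_less_mult_iff)
  have xu: "\<bar>x u\<bar> = m * y u" using u y[OF u(1)] by (auto simp: R_def)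
  have "q G * \<bar>x u\<bar> \<le> \<bar>signless_laplacian G x u\<bar>"
    unfolding x[OF u(1)] by (simp add: abs_mult mult_right_mono)
  also have "\<dots> \<le> real (Defs.degree G u) * \<bar>x u\<bar> + (\<Sum>w | w \<in> verts G \<and> adj G u w. \<bar>x w\<bar>)"
    unfolding signless_laplacian_def
    by (rule order_trans[OF abs_triangle_ineq add_mono]) (auto simp: abs_mult)
  also have "\<dots> \<le> real (Defs.degree G u) * (m * y u) + (\<Sum>w | w \<in> verts G \<and> adj G u w. m * y w)"
    unfolding xu by (intro add_mono sum_mono le) auto
  also have "\<dots> = m * signless_laplacian G y u"
    by (simp add: signless_laplacian_def sum_distrib_left algebra_simps)
  finally have "m * (q G * y u) \<le> m * signless_laplacian G y u"
    unfolding xu by (simp add: mult_ac)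
  with m u(1) show ?thesis by auto
qed

lemma q_le_of_rows:
  assumes "finite (verts G)" "verts G \<noteq> {}" "\<And>v. v \<in> verts G \<Longrightarrow> 0 < y v"
    and "\<And>v. v \<in> verts G \<Longrightarrow> signless_laplacian G y v \<le> c * y v"
  shows "q G \<le> c"
  using q_row_bound[OF assms(1-3)] assms(3,4) by (meson mult_le_cancel_right_pos order_trans)

lemma q_less_of_rows:
  assumes "finite (verts G)" "verts G \<noteq> {}" "\<And>v. v \<in> verts G \<Longrightarrow> 0 < y v"
    and "\<And>v. v \<in> verts G \<Longrightarrow> signless_laplacian G y v < c * y v"
  shows "q G < c"
  using q_row_bound[OF assms(1-3)] assms(3,4) by (meson mult_less_cancel_right_pos le_less_trans)

text \<open>The row bound gives \<open>q G \<le> c\<close>, and c is itself an eigenvalue, so it is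
  at most the maximum.\<close>

lemma q_eq_of_positive_eigenvector:
  assumes "finite (verts G)" "verts G \<noteq> {}" "\<And>v. v \<in> verts G \<Longrightarrow> 0 < y v"
    and "\<And>v. v \<in> verts G \<Longrightarrow> signless_laplacian G y v = c * y v"
  shows "q G = c"
proof (rule antisym)
  show "q G \<le> c" using assms by (intro q_le_of_rows[of G y]) auto
  obtain u where "u \<in> verts G" using assms(2) by blast
  then have "Q_eigenvalue G c" using assms(3,4) by (intro Q_eigenvalueI[of u G y]) (auto simp: less_le)
  then show "c \<le> q G" using assms(1) by (rule Q_eigenvalue_le_q[rotated])
qed

section \<open>Isomorphism invariance\<close>

lemma isomorphic_Q_eigenvalue:
  assumes "isomorphic G H" "Q_eigenvalue H k"
  shows "Q_eigenvalue G k"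
proof -
  obtain f where f: "bij_betw f (verts G) (verts H)"
    and a: "\<And>u v. u \<in> verts G \<Longrightarrow> v \<in> verts G \<Longrightarrow> adj G u v \<longleftrightarrow> adj H (f u) (f v)"
    using assms(1) unfolding isomorphic_def by blast
  obtain x u where x: "u \<in> verts H" "x u \<noteq> 0"
    "\<And>v. v \<in> verts H \<Longrightarrow> signless_laplacian H x v = k * x v"
    using assms(2) unfolding Q_eigenvalue_def by blast
  have nb: "bij_betw f {w \<in> verts G. adj G v w} {w \<in> verts H. adj H (f v) w}" if "v \<in> verts G" for v
  proof (rule bij_betw_subset[OF f])
    show "f ` {w \<in> verts G. adj G v w} = {w \<in> verts H. adj H (f v) w}"
      using f a[OF that] by (force simp: bij_betw_def)
  qed auto
  have "signless_laplacian G (x \<circ> f) v = signless_laplacian H x (f v)" if "v \<in> verts G" for v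
    unfolding signless_laplacian_def Defs.degree_def
    using bij_betw_same_card[OF nb[OF that]] sum.reindex_bij_betw[OF nb[OF that], of x] by simp
  moreover obtain u' where "u' \<in> verts G" "f u' = u" using f x(1) by (metis bij_betw_imp_surj_on imageE)
  ultimately show ?thesis
    using x f by (intro Q_eigenvalueI[of u' G "x \<circ> f"]) (auto simp: bij_betw_def)
qed

lemma isomorphic_sym: "isomorphic G H \<Longrightarrow> isomorphic H G"
  unfolding isomorphic_def
proof (elim exE conjE)
  fix f assume f: "bij_betw f (verts G) (verts H)"
    "\<forall>u\<in>verts G. \<forall>v\<in>verts G. adj G u v \<longleftrightarrow> adj H (f u) (f v)"
  let ?g = "inv_into (verts G) f"
  have "?g u \<in> verts G" "f (?g u) = u" if "u \<in> verts H" for u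
    using that f(1) bij_betw_apply[OF bij_betw_inv_into[OF f(1)]]
    by (auto simp: bij_betw_inv_into_right)
  then show "\<exists>g. bij_betw g (verts H) (verts G) \<and>
      (\<forall>u\<in>verts H. \<forall>v\<in>verts H. adj H u v \<longleftrightarrow> adj G (g u) (g v))"
    using f(2) bij_betw_inv_into[OF f(1)] by (intro exI[of _ ?g]) simp
qed

lemma isomorphic_q_eq: "isomorphic G H \<Longrightarrow> q G = q H"
  unfolding q_def by (meson isomorphic_Q_eigenvalue isomorphic_sym)

section \<open>Weights on paths and triangles\<close>

text \<open>With \<open>t = \<lambda> - 5\<close> and value 1 at the apex, the \<open>\<lambda>\<close>-eigenvector takes the value
  \<open>1 / (t + 6 - 2 b)\<close> on every vertex of a block \<open>K\<^sub>b\<close>; this is its total over \<open>k\<close> vertices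
  split into triangles and one smaller block, so \<open>q F = t + 5\<close> where
  \<open>t + 5 = (n - 1) + block_weight t (n - 1)\<close>.\<close>
definition block_weight :: "real \<Rightarrow> nat \<Rightarrow> real" where
  "block_weight t k = 3 * real (k div 3) / t + real (k mod 3) / (t + 6 - 2 * real (k mod 3))"

section \<open>Superadditivity and bounds for block weights\<close>

lemma block_weight_eq: "r < 3 \<Longrightarrow> block_weight t (3 * d + r) = 3 * real d / t + real r / (t + 6 - 2 * real r)"
  by (simp add: block_weight_def)

lemma mod3_cases:
  fixes k :: nat
  obtains d where "k = 3 * d" | d where "k = 3 * d + 1" | d where "k = 3 * d + 2"
proof -
  have "k = 3 * (k div 3) + k mod 3" "k mod 3 = 0 \<or> k mod 3 = 1 \<or> k mod 3 = 2" by auto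
  then show ?thesis using that by (metis add.right_neutral)
qed

lemma block_weight_mod3:
  "block_weight t (3 * d) = 3 * real d / t"
  "block_weight t (3 * d + 1) = 3 * real d / t + 1 / (t + 4)"
  "block_weight t (3 * d + 2) = 3 * real d / t + 2 / (t + 2)"
  using block_weight_eq[of 0 t d] block_weight_eq[of 1 t d] block_weight_eq[of 2 t d] by simp_all

text \<open>The fractions \<open>1 / (t + 4)\<close>, \<open>1 / (t + 2)\<close>,
  \<open>1 / t\<close> are the weights of a vertex in a block of size 1, 2, 3. The third inequality
  is convexity of the reciprocal at t, t + 2, t + 4; the fourth compares two blocks of size 2 with
  blocks of sizes 3 and 1.\<close>

lemma weight_ineqs:
  fixes t :: real
  assumes "t > 0"
  shows "1 / (t + 4) < 1 / (t + 2)" "1 / (t + 2) < 1 / t"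
    "2 / (t + 2) < 1 / t + 1 / (t + 4)" "4 / (t + 2) < 3 / t + 1 / (t + 4)"
proof -
  show 1: "1 / (t + 4) < 1 / (t + 2)" "1 / (t + 2) < 1 / t"
    using assms by (simp_all add: field_simps)
  have "1 / t + 1 / (t + 4) - 2 / (t + 2) = 8 / (t * (t + 2) * (t + 4))"
    using assms by (simp add: divide_simps) (simp add: algebra_simps)
  moreover have "8 / (t * (t + 2) * (t + 4)) > 0" using assms by simp
  ultimately show 2: "2 / (t + 2) < 1 / t + 1 / (t + 4)" by linarith
  have "2 * (1 / (t + 2)) < 2 * (1 / t)" using 1(2) by (rule mult_strict_left_mono) simp
  with 2 show "4 / (t + 2) < 3 / t + 1 / (t + 4)" by simp
qed

text \<open>Triangles add up exactly, so only the remainders matter. Two nonzero remainders are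
  repacked with strict gain: 1 + 1 into a block of size 2, 1 + 2 into a triangle, 2 + 2 into a
  triangle and a single vertex. The strict part drives the equality case.\<close>

lemma block_weight_superadditive:
  assumes "t > 0"
  shows "block_weight t i + block_weight t j \<le> block_weight t (i + j)"
    and "i mod 3 \<noteq> 0 \<Longrightarrow> j mod 3 \<noteq> 0 \<Longrightarrow> block_weight t i + block_weight t j < block_weight t (i + j)"
proof -
  note w = weight_ineqs[OF assms]
  have dist: "3 * real (d + d') / t = 3 * real d / t + 3 * real d' / t"
    "3 * real (Suc d) / t = 3 * real d / t + 3 / t" for d d'
    by (simp_all add: add_divide_distrib distrib_left)
  have "block_weight t i + block_weight t j \<le> block_weight t (i + j) \<and>
      (i mod 3 \<noteq> 0 \<and> j mod 3 \<noteq> 0 \<longrightarrow> block_weight t i + block_weight t j < block_weight t (i + j))"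
  proof (cases i rule: mod3_cases; cases j rule: mod3_cases)
    fix d d' assume ij: "i = 3 * d" "j = 3 * d'"
    have "i + j = 3 * (d + d')" by (simp add: ij)
    then show ?thesis by (simp only: ij block_weight_mod3 dist) simp
  next
    fix d d' assume ij: "i = 3 * d" "j = 3 * d' + 1"
    have "i + j = 3 * (d + d') + 1" by (simp add: ij)
    then show ?thesis by (simp only: ij block_weight_mod3 dist) simp
  next
    fix d d' assume ij: "i = 3 * d" "j = 3 * d' + 2"
    have "i + j = 3 * (d + d') + 2" by (simp add: ij)
    then show ?thesis by (simp only: ij block_weight_mod3 dist) simp
  next
    fix d d' assume ij: "i = 3 * d + 1" "j = 3 * d'"
    have "i + j = 3 * (d + d') + 1" by (simp add: ij)
    then show ?thesis by (simp only: ij block_weight_mod3 dist) simp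
  next
    fix d d' assume ij: "i = 3 * d + 1" "j = 3 * d' + 1"
    have "i + j = 3 * (d + d') + 2" by (simp add: ij)
    then show ?thesis using w by (simp only: ij block_weight_mod3 dist) simp
  next
    fix d d' assume ij: "i = 3 * d + 1" "j = 3 * d' + 2"
    have "i + j = 3 * Suc (d + d')" by (simp add: ij)
    then show ?thesis using w by (simp only: ij block_weight_mod3 dist) simp
  next
    fix d d' assume ij: "i = 3 * d + 2" "j = 3 * d'"
    have "i + j = 3 * (d + d') + 2" by (simp add: ij)
    then show ?thesis by (simp only: ij block_weight_mod3 dist) simp
  next
    fix d d' assume ij: "i = 3 * d + 2" "j = 3 * d' + 1"
    have "i + j = 3 * Suc (d + d')" by (simp add: ij)
    then show ?thesis using w by (simp only: ij block_weight_mod3 dist) simp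
  next
    fix d d' assume ij: "i = 3 * d + 2" "j = 3 * d' + 2"
    have "i + j = 3 * Suc (d + d') + 1" by (simp add: ij)
    then show ?thesis using w by (simp only: ij block_weight_mod3 dist) simp
  qed
  then show "block_weight t i + block_weight t j \<le> block_weight t (i + j)"
    and "i mod 3 \<noteq> 0 \<Longrightarrow> j mod 3 \<noteq> 0 \<Longrightarrow> block_weight t i + block_weight t j < block_weight t (i + j)" by auto
qed

text \<open>A bound without case distinction on k, exact for k = 2 mod 3; long paths are compared
  with it.\<close>

lemma block_weight_lower:
  assumes "t > 0"
  shows "(real k - 2) / t + 2 / (t + 2) \<le> block_weight t k"
proof (cases k rule: mod3_cases)
  case (1 d)
  then show ?thesis using weight_ineqs[OF assms] by (simp add: block_weight_mod3(1) diff_divide_distrib)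
next
  case (2 d)
  then show ?thesis
    using weight_ineqs[OF assms] by (simp only: block_weight_mod3) (simp add: diff_divide_distrib)
next
  case (3 d)
  then show ?thesis by (simp only: block_weight_mod3) simp
qed

lemma block_weight_le: "t > 0 \<Longrightarrow> block_weight t k \<le> real k / t"
proof (cases k rule: mod3_cases)
  case (3 d)
  assume "t > 0"
  then have "2 * (1 / (t + 2)) \<le> 2 * (1 / t)"
    using weight_ineqs(2) by (intro mult_left_mono less_imp_le) auto
  then show ?thesis by (simp only: 3 block_weight_mod3) (simp add: add_divide_distrib)
next
  case (2 d)
  assume "t > 0"
  then have "1 / (t + 4) \<le> 1 / t" by (intro divide_left_mono) auto
  then show ?thesis by (simp only: 2 block_weight_mod3) (simp add: add_divide_distrib)
qed (simp add: block_weight_mod3(1))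

lemma block_weight_antimono:
  assumes "0 < t" "t \<le> t'"
  shows "block_weight t' k \<le> block_weight t k"
proof -
  have "real (k mod 3) \<le> 2" using less_Suc_eq_le[of "k mod 3" 2] by simp
  then show ?thesis
    unfolding block_weight_def using assms by (intro add_mono divide_left_mono mult_pos_pos) auto
qed

text \<open>\<open>t + 5\<close> will be the value of q at the extremal graph, and
  \<open>t > real n - 5\<close> puts it above n, the bound for graphs without a vertex of degree n -
  1.\<close>

lemma block_weight_fixpoint:
  assumes "n \<ge> 6"
  obtains t where "t > real n - 5" "t + 5 = real (n - 1) + block_weight t (n - 1)"
proof -
  define h where "h t = t + 5 - real (n - 1) - block_weight t (n - 1)" for t
  have n: "real (n - 1) = real n - 1" using assms by simp
  \<comment> \<open>At t = n - 5 the block weight exceeds 1, so h is negative; at t = 2 n it is at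
    most 1, so h is nonnegative.\<close>
  have "(real (n - 1) - 2) / (real n - 5) + 2 / ((real n - 5) + 2) \<le> block_weight (real n - 5) (n - 1)"
    using assms by (intro block_weight_lower) auto
  moreover have "(real (n - 1) - 2) / (real n - 5) \<ge> 1" "2 / ((real n - 5) + 2) > 0"
    using assms n by (auto simp: field_simps)
  ultimately have neg: "h (real n - 5) < 0" unfolding h_def n by linarith
  have "block_weight (2 * real n) (n - 1) \<le> real (n - 1) / (2 * real n)"
    using assms by (intro block_weight_le) auto
  also have "\<dots> \<le> 1" using assms by (simp add: field_simps)
  finally have pos: "h (2 * real n) \<ge> 0" unfolding h_def n by simp
  \<comment> \<open>Keeps the denominator \<open>t + 6 - 2 * r\<close> positive, hence h
    continuous.\<close>
  have "real ((n - 1) mod 3) \<le> 2" using less_Suc_eq_le[of "(n - 1) mod 3" 2] by simp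
  then have "continuous_on {real n - 5..2 * real n} h"
    unfolding h_def block_weight_def using assms by (intro continuous_intros) auto
  then obtain t where t: "real n - 5 \<le> t" "h t = 0"
    using IVT'[of h "real n - 5" 0 "2 * real n"] neg pos by auto
  have "t \<noteq> real n - 5" using t(2) neg by auto
  with t show ?thesis by (intro that[of t]) (auto simp: h_def)
qed

text \<open>End and second-vertex weights of a path all of whose other vertices get \<open>1 / t\<close>. The
  correction at the second vertex is needed: with \<open>s = 1 / t\<close> the total for \<open>P\<^sub>5\<close> would
  exceed that of \<open>K\<^sub>3 \<union> K\<^sub>2\<close>, which agrees with it up to third order in \<open>1 / t\<close>.\<close>
lemma path_end_weights:
  fixes t :: real
  assumes "t > 0"
  obtains e s where "0 < e" "e < 1 / t" "0 < s" "s < 1 / t"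
    "(t + 3) * e = 1 + s" "(t + 2) * s = 1 + e + 1 / t" "e + s < 1 / t + 1 / (t + 2)"
proof -
  \<comment> \<open>e and s solve the two linear equations of the conclusion: their determinant is
    (t + 3)(t + 2) - 1 = t^2 + 5 t + 5, and the factor t clears the term
    \<open>1 / t\<close>.\<close>
  define P where "P = t * (t\<^sup>2 + 5 * t + 5)"
  define e where "e = (t\<^sup>2 + 3 * t + 1) / P"
  define s where "s = (t\<^sup>2 + 5 * t + 3) / P"
  have R: "t\<^sup>2 + 5 * t + 5 > 0" using assms by (simp add: add_pos_pos)
  then have P: "P > 0" using assms by (simp add: P_def)
  show ?thesis
  proof
    show "0 < e" "0 < s" using P assms by (simp_all add: e_def s_def add_pos_pos)
    have inv_t: "1 / t = (t\<^sup>2 + 5 * t + 5) / P" using assms P unfolding P_def zero_less_mult_iff by auto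
    show "e < 1 / t" "s < 1 / t"
      unfolding inv_t unfolding e_def s_def using assms P by (auto intro!: divide_strict_right_mono)
    show "(t + 3) * e = 1 + s"
      using P by (simp add: e_def s_def field_simps) (simp add: P_def power2_eq_square algebra_simps)
    show "(t + 2) * s = 1 + e + 1 / t"
      unfolding inv_t using P
      by (simp add: e_def s_def field_simps) (simp add: P_def power2_eq_square algebra_simps)
    have "e + s = (2 * t\<^sup>2 + 8 * t + 4) / P" by (simp add: e_def s_def add_divide_distrib[symmetric])
    \<comment> \<open>After cancelling t and cross-multiplying, the two sides differ only by the
      constant 2.\<close>
    also have "\<dots> < (2 * t + 2) / (t * (t + 2))"
      using assms P R unfolding P_def
      by (simp add: divide_simps) (simp add: power2_eq_square algebra_simps)
    also have "\<dots> = 1 / t + 1 / (t + 2)" using assms by (simp add: field_simps)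
    finally show "e + s < 1 / t + 1 / (t + 2)" .
  qed
qed

text \<open>p weights the path 0, ..., k - 1, a missing neighbour counting as 0. The inequality is
  the row bound \<open>t + 5\<close> at i with an apex of weight 1. Equality of totals occurs only
  for k at most 2, when the path is complete and the exact block weights are used.\<close>

lemma path_weights:
  assumes t: "t > 0" and "k > 0"
  obtains p :: "nat \<Rightarrow> real" where "\<And>i. i < k \<Longrightarrow> 0 < p i"
    "\<And>i. i < k \<Longrightarrow> 1 + ((if 0 < i then p (i - 1) else 0) + (if Suc i < k then p (Suc i) else 0))
       \<le> (t + 4 - real (of_bool (0 < i) + of_bool (Suc i < k))) * p i"
    "(\<Sum>i<k. p i) < block_weight t k \<or> k \<le> 2 \<and> (\<Sum>i<k. p i) = block_weight t k"
proof -
  consider "k = 1" | "k = 2" | "k \<ge> 3" using assms(2) by linarith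
  then show ?thesis
  proof cases
    case 1
    then show ?thesis using t by (intro that[of "\<lambda>_. 1 / (t + 4)"]) (auto simp: block_weight_def)
  next
    case 2
    have "i = 0 \<or> i = 1" if "i < k" for i using that 2 by auto
    then show ?thesis using t 2
      by (intro that[of "\<lambda>_. 1 / (t + 2)"]) (fastforce simp: block_weight_def field_simps)+
  next
    case 3
    obtain e s where es: "0 < e" "e < 1 / t" "0 < s" "s < 1 / t"
      "(t + 3) * e = 1 + s" "(t + 2) * s = 1 + e + 1 / t" "e + s < 1 / t + 1 / (t + 2)"
      using path_end_weights[OF t] by metis
    define p where "p i = (if i = 0 \<or> i = k - 1 then e else if i = 1 \<or> i = k - 2 then s else 1 / t)" for i
    \<comment> \<open>The equation for s assumes an inner neighbour of weight \<open>1 / t\<close>.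
      On three or four vertices that neighbour is an end or the other second vertex, whose smaller
      weight only helps.\<close>
    have p_le: "p i \<le> 1 / t" for i using es by (auto simp: p_def)
    show ?thesis
    proof (rule that[of p])
      show "\<And>i. i < k \<Longrightarrow> 0 < p i" using es t by (auto simp: p_def)
      fix i assume i: "i < k"
      consider "i = 0" | "i = k - 1" | "i = 1" "i \<noteq> k - 1" | "i = k - 2" "i > 0" "i \<noteq> 1"
        | "2 \<le> i" "i < k - 2" using i by linarith
      then show "1 + ((if 0 < i then p (i - 1) else 0) + (if Suc i < k then p (Suc i) else 0))
       \<le> (t + 4 - real (of_bool (0 < i) + of_bool (Suc i < k))) * p i"
      proof cases
        case 1
        then have "\<not> 0 < i" "Suc i < k" "p i = e" "p (Suc i) = s" using \<open>3 \<le> k\<close> by (auto simp: p_def)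
        then show ?thesis using es(5) by (simp add: add.commute)
      next
        case 2
        then have "0 < i" "\<not> Suc i < k" "p i = e" "p (i - 1) = s" using \<open>3 \<le> k\<close> by (auto simp: p_def)
        then show ?thesis using es(5) by (simp add: add.commute)
      next
        case 3
        then have "0 < i" "Suc i < k" "p (i - 1) = e" "p i = s" using \<open>3 \<le> k\<close> i by (auto simp: p_def)
        then show ?thesis using es(6) p_le[of "Suc i"] by (simp add: algebra_simps)
      next
        case 4
        then have "0 < i" "Suc i < k" "p (Suc i) = e" "p i = s" using \<open>3 \<le> k\<close> i by (auto simp: p_def)
        then show ?thesis using es(6) p_le[of "i - 1"] by (simp add: algebra_simps)
      next
        case 5
        then have "0 < i" "Suc i < k" "p i = 1 / t" by (auto simp: p_def)
        moreover have "(t + 2) * (1 / t) = 1 + (1 / t + 1 / t)" using t by (simp add: field_simps)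
        ultimately show ?thesis using p_le[of "i - 1"] p_le[of "Suc i"] by (simp add: algebra_simps)
      qed
    next
      show "(\<Sum>i<k. p i) < block_weight t k \<or> k \<le> 2 \<and> (\<Sum>i<k. p i) = block_weight t k"
      \<comment> \<open>With three vertices both second vertices coincide, so s is counted once;
        from four on the total is 2 e + 2 s + (k - 4) / t.\<close>
      proof (cases "k = 3")
        case True
        then have "(\<Sum>i<k. p i) = e + s + e" by (simp add: p_def numeral_eq_Suc)
        also have "\<dots> < 3 / t" using es by simp
        finally show ?thesis using True by (simp add: block_weight_def)
      next
        case False
        with 3 have "k = Suc (Suc (Suc (Suc (k - 4))))" by simp
        then obtain m where k: "k = Suc (Suc (Suc (Suc m)))" by blast
        have "(\<Sum>i<k. p i) = (\<Sum>i<m. p (Suc (Suc i))) + 2 * e + 2 * s"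
          unfolding k by (subst sum.lessThan_Suc, subst sum.lessThan_Suc,
            subst sum.lessThan_Suc_shift, subst sum.lessThan_Suc_shift) (simp add: p_def k)
        also have "(\<Sum>i<m. p (Suc (Suc i))) = real m / t" by (simp add: p_def k)
        also have "real m / t + 2 * e + 2 * s < (real k - 2) / t + 2 / (t + 2)"
          using es(7) by (simp add: k add_divide_distrib)
        also have "\<dots> \<le> block_weight t k" by (rule block_weight_lower[OF t])
        finally show ?thesis ..
      qed
    qed
  qed
qed

text \<open>The condition \<open>Q y \<le> (t + 5) y\<close> of the join of \<open>W\<close> with an apex of weight 1, at the
  vertices of \<open>W\<close>.\<close>
definition weight_supersolution :: "real \<Rightarrow> 'a set \<Rightarrow> ('a \<Rightarrow> 'a \<Rightarrow> bool) \<Rightarrow> ('a \<Rightarrow> real) \<Rightarrow> bool" where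
  "weight_supersolution t W E y \<longleftrightarrow> (\<forall>u\<in>W. 0 < y u \<and>
     1 + (\<Sum>w | w \<in> W \<and> E u w. y w) \<le> (t + 4 - real (card {w \<in> W. E u w})) * y u)"

text \<open>The numbering used by \<open>F_graph\<close> for its vertices other than 0, shifted down
  by one: consecutive triples are triangles, and the last \<open>card W mod 3\<close> numbers form
  the short block.\<close>

definition triangle_blocks :: "'a set \<Rightarrow> ('a \<Rightarrow> 'a \<Rightarrow> bool) \<Rightarrow> bool" where
  "triangle_blocks W E \<longleftrightarrow> (\<exists>f. bij_betw f W {..<card W} \<and>
     (\<forall>u\<in>W. \<forall>w\<in>W. u \<noteq> w \<longrightarrow> (E u w \<longleftrightarrow> f u div 3 = f w div 3)))"

definition no_long_cycle :: "'a set \<Rightarrow> ('a \<Rightarrow> 'a \<Rightarrow> bool) \<Rightarrow> bool" where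
  "no_long_cycle W E \<longleftrightarrow> (\<forall>cs. set cs \<subseteq> W \<longrightarrow> distinct cs \<longrightarrow> 4 \<le> length cs \<longrightarrow>
     successively E cs \<longrightarrow> \<not> E (last cs) (hd cs))"

section \<open>Components of a graph of maximum degree 2\<close>

lemma maximal_path_exists:
  assumes "finite W" "W \<noteq> {}" and sym: "\<And>u w. E u w \<Longrightarrow> E w u"
  obtains ps where "ps \<noteq> []" "set ps \<subseteq> W" "distinct ps" "successively E ps"
    "\<And>w. w \<in> W \<Longrightarrow> E (hd ps) w \<Longrightarrow> w \<in> set ps" "\<And>w. w \<in> W \<Longrightarrow> E (last ps) w \<Longrightarrow> w \<in> set ps"
proof -
  define P where "P ps \<longleftrightarrow> ps \<noteq> [] \<and> set ps \<subseteq> W \<and> distinct ps \<and> successively E ps" for ps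
  obtain a where "a \<in> W" using assms(2) by blast
  then have "P [a]" by (simp add: P_def)
  \<comment> \<open>Path lengths are bounded, so a longest path exists; a neighbour of an end off
    the path would prolong it.\<close>
  moreover have "\<forall>ps. P ps \<longrightarrow> length ps < Suc (card W)"
    unfolding P_def using assms(1) by (metis card_mono distinct_card less_Suc_eq_le)
  ultimately obtain ps where ps: "P ps" and max: "\<And>qs. P qs \<Longrightarrow> length qs \<le> length ps"
    using ex_has_greatest_nat[of P "[a]" length] by blast
  show ?thesis
  proof (rule that[of ps])
    fix w assume w: "w \<in> W" "E (hd ps) w"
    show "w \<in> set ps"
    proof (rule ccontr)
      assume "w \<notin> set ps"
      then have "P (w # ps)" using ps w sym by (cases ps) (auto simp: P_def)
      from max[OF this] show False by simp
    qed
  next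
    fix w assume w: "w \<in> W" "E (last ps) w"
    show "w \<in> set ps"
    proof (rule ccontr)
      assume "w \<notin> set ps"
      then have "P (ps @ [w])" using ps w by (auto simp: P_def successively_append_iff)
      from max[OF this] show False by simp
    qed
  qed (use ps in \<open>auto simp: P_def\<close>)
qed

text \<open>The vertex set of a maximal path is closed under adjacency: inner vertices have used up
  their degree 2 on the path, and the ends cannot be extended. The only possible extra edge joins
  the two ends, so the component is a path or a cycle, and the cycle must be a triangle. Equality
  leaves only complete graphs on at most 3 vertices.\<close>

lemma extremal_component:
  fixes W :: "'a set"
  assumes t: "t > 0" and W: "finite W" "W \<noteq> {}"
    and sym: "\<And>u w. E u w \<Longrightarrow> E w u" and irr: "\<And>u. \<not> E u u"
    and deg: "\<And>u. u \<in> W \<Longrightarrow> card {w \<in> W. E u w} \<le> 2" and cyc: "no_long_cycle W E"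
  obtains C y where "C \<subseteq> W" "C \<noteq> {}" "\<forall>u\<in>C. \<forall>w\<in>W. E u w \<longrightarrow> w \<in> C"
    "weight_supersolution t C E y"
    "sum y C < block_weight t (card C) \<or>
      card C \<le> 3 \<and> sum y C = block_weight t (card C) \<and> (\<forall>u\<in>C. \<forall>w\<in>C. u \<noteq> w \<longrightarrow> E u w)"
proof -
  obtain ps where ps: "ps \<noteq> []" "set ps \<subseteq> W" "distinct ps" "successively E ps"
    and hd: "\<And>w. w \<in> W \<Longrightarrow> E (hd ps) w \<Longrightarrow> w \<in> set ps"
    and last: "\<And>w. w \<in> W \<Longrightarrow> E (last ps) w \<Longrightarrow> w \<in> set ps"
    by (rule maximal_path_exists[where E = E, OF W sym]) blast+
  define k where "k = length ps"
  have k: "k > 0" using ps(1) by (simp add: k_def)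
  have in_W: "ps ! i \<in> W" if "i < k" for i using ps(2) that by (auto simp: k_def)
  have nth_eq: "ps ! i = ps ! j \<longleftrightarrow> i = j" if "i < k" "j < k" for i j
    using ps(3) that by (simp add: k_def nth_eq_iff_index_eq)
  have step: "E (ps ! i) (ps ! Suc i)" if "Suc i < k" for i
    using ps(4) that by (simp add: k_def successively_conv_nth)
  have C: "set ps = (!) ps ` {..<k}" by (auto simp: k_def in_set_conv_nth)
  have card_C: "card (set ps) = k" using ps(3) by (simp add: k_def distinct_card)
  have inner: "{w \<in> W. E (ps ! i) w} = {ps ! (i - 1), ps ! Suc i}" if "0 < i" "Suc i < k" for i
  proof -
    have "{ps ! (i - 1), ps ! Suc i} \<subseteq> {w \<in> W. E (ps ! i) w}"
      using step[of i] step[of "i - 1"] sym in_W that by auto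
    moreover have "card {ps ! (i - 1), ps ! Suc i} = 2" using nth_eq[of "i - 1" "Suc i"] that by simp
    ultimately show ?thesis
      using card_seteq[of "{w \<in> W. E (ps ! i) w}" "{ps ! (i - 1), ps ! Suc i}"] deg[OF in_W, of i] W(1) that
      by auto
  qed
  have closed: "w \<in> set ps" if "u \<in> set ps" "w \<in> W" "E u w" for u w
  proof -
    obtain i where i: "i < k" "u = ps ! i" using \<open>u \<in> set ps\<close> by (auto simp: C)
    consider "i = 0" | "i = k - 1" | "0 < i" "Suc i < k" using i by linarith
    then show ?thesis
    proof cases
      case 1
      then show ?thesis using hd that i ps(1) by (simp add: hd_conv_nth)
    next
      case 2
      then show ?thesis using last that i ps(1) by (simp add: last_conv_nth k_def)
    next
      case 3
      then have "w \<in> {ps ! (i - 1), ps ! Suc i}" using inner[of i] that i by blast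
      with 3 show ?thesis by (auto simp: C)
    qed
  qed
  have chord: "j = Suc i \<or> i = 0 \<and> j = k - 1" if ij: "i < j" "j < k" "E (ps ! i) (ps ! j)" for i j
  proof -
    consider "0 < i" | "i = 0" "Suc j < k" | "i = 0" "j = k - 1" using ij by linarith
    then show ?thesis
    proof cases
      case 1
      then have "ps ! j = ps ! (i - 1) \<or> ps ! j = ps ! Suc i" using inner[of i] that in_W[of j] by auto
      then show ?thesis using that nth_eq by auto
    next
      case 2
      then have "ps ! i = ps ! (j - 1) \<or> ps ! i = ps ! Suc j"
        using inner[of j] that in_W[of i] sym by auto
      then show ?thesis using that 2 nth_eq by auto
    qed auto
  qed
  show ?thesis
  \<comment> \<open>For k = 2 the edge between the ends is the path edge itself and closes no
    cycle.\<close>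
  proof (cases "k \<ge> 3 \<and> E (ps ! (k - 1)) (ps ! 0)")
    case True
    have "\<not> 4 \<le> k"
      using cyc True ps unfolding no_long_cycle_def
      by (metis hd_conv_nth k_def last_conv_nth)
    with True have k3: "k = 3" by simp
    have less3: "i = 0 \<or> i = 1 \<or> i = 2" if "i < 3" for i :: nat using that by auto
    have "E (ps ! 0) (ps ! 1)" "E (ps ! 1) (ps ! 2)" "E (ps ! 2) (ps ! 0)"
      using step[of 0] step[of 1] True k3 by (simp_all add: numeral_2_eq_2)
    then have full: "E u w" if "u \<in> set ps" "w \<in> set ps" "u \<noteq> w" for u w
      using that sym unfolding C k3 by (auto dest!: less3)
    have N: "{w \<in> set ps. E u w} = set ps - {u}" if "u \<in> set ps" for u
      using that full irr by auto
    show ?thesis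
    proof (rule that[OF ps(2)])
      \<comment> \<open>On a triangle the rows hold with equality: 1 + 2 / t = (t + 2) / t.\<close>
      show "weight_supersolution t (set ps) E (\<lambda>_. 1 / t)"
        unfolding weight_supersolution_def using t by (simp add: N card_C k3 field_simps)
      show "(\<Sum>_\<in>set ps. 1 / t) < block_weight t (card (set ps)) \<or> card (set ps) \<le> 3 \<and>
          (\<Sum>_\<in>set ps. 1 / t) = block_weight t (card (set ps)) \<and> (\<forall>u\<in>set ps. \<forall>w\<in>set ps. u \<noteq> w \<longrightarrow> E u w)"
        using full card_C k3 by (simp add: block_weight_def)
    qed (use ps(1) closed in auto)
  next
    case False
    have E_iff: "E (ps ! i) (ps ! j) \<longleftrightarrow> j = Suc i \<or> i = Suc j" if "i < k" "j < k" for i j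
    proof -
      have le: "b = Suc a" if "a < b" "b < k" "E (ps ! a) (ps ! b)" for a b
      proof -
        have "\<not> (3 \<le> k \<and> a = 0 \<and> b = k - 1)" using that(3) sym False by auto
        with chord[OF that] that(1,2) show ?thesis by auto
      qed
      consider "i < j" | "j < i" | "i = j" by linarith
      then show ?thesis using le that sym step irr by cases auto
    qed
    obtain p where p: "\<And>i. i < k \<Longrightarrow> 0 < p i"
      "\<And>i. i < k \<Longrightarrow> 1 + ((if 0 < i then p (i - 1) else 0) + (if Suc i < k then p (Suc i) else 0))
         \<le> (t + 4 - real (of_bool (0 < i) + of_bool (Suc i < k))) * p i"
      "(\<Sum>i<k. p i) < block_weight t k \<or> k \<le> 2 \<and> (\<Sum>i<k. p i) = block_weight t k"
      using path_weights[OF t k] by metis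
    define y where "y u = p (inv_into {..<k} ((!) ps) u)" for u
    have inj: "inj_on ((!) ps) {..<k}" using nth_eq by (auto simp: inj_on_def)
    have y: "y (ps ! i) = p i" if "i < k" for i
      unfolding y_def using inj that by simp
    have sum_y: "sum y (set ps) = (\<Sum>i<k. p i)"
      unfolding C by (simp add: sum.reindex[OF inj] y)
    show ?thesis
    proof (rule that[OF ps(2)])
      show "weight_supersolution t (set ps) E y"
        unfolding weight_supersolution_def
      proof
        fix u assume "u \<in> set ps"
        then obtain i where i: "i < k" "u = ps ! i" by (auto simp: C)
        define J where "J = (if 0 < i then {i - 1} else {}) \<union> (if Suc i < k then {Suc i} else {})"
        have J: "J \<subseteq> {..<k}" using i by (auto simp: J_def)
        have "{w \<in> set ps. E u w} = (!) ps ` {j \<in> {..<k}. E (ps ! i) (ps ! j)}"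
          unfolding C i(2) by auto
        also have "{j \<in> {..<k}. E (ps ! i) (ps ! j)} = J"
          using i(1) by (auto simp: E_iff J_def)
        finally have N: "{w \<in> set ps. E u w} = (!) ps ` J" .
        have injJ: "inj_on ((!) ps) J" using inj J by (rule inj_on_subset)
        have "sum y ((!) ps ` J) = sum p J"
          using J by (auto simp: sum.reindex[OF injJ] y intro!: sum.cong)
        also have "\<dots> = (if 0 < i then p (i - 1) else 0) + (if Suc i < k then p (Suc i) else 0)"
          by (auto simp: J_def)
        finally have sumN: "sum y {w \<in> set ps. E u w}
          = (if 0 < i then p (i - 1) else 0) + (if Suc i < k then p (Suc i) else 0)" by (simp only: N)
        have "card {w \<in> set ps. E u w} = of_bool (0 < i) + of_bool (Suc i < k)"
          unfolding N card_image[OF injJ] by (auto simp: J_def)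
        then show "0 < y u \<and> 1 + sum y {w \<in> set ps. E u w} \<le> (t + 4 - real (card {w \<in> set ps. E u w})) * y u"
          using p(1,2)[OF i(1)] i y unfolding sumN by simp
      qed
      \<comment> \<open>The equality case of the path weights has k at most 2, and such a path is
        complete.\<close>
      have "E u w" if "k \<le> 2" "u \<in> set ps" "w \<in> set ps" "u \<noteq> w" for u w
      proof -
        obtain i j where ij: "i < k" "u = ps ! i" "j < k" "w = ps ! j"
          using \<open>u \<in> _\<close> \<open>w \<in> _\<close> by (auto simp: C)
        then have "i \<noteq> j" using \<open>u \<noteq> w\<close> by auto
        then have "j = Suc i \<or> i = Suc j" using \<open>k \<le> 2\<close> ij by linarith
        then show ?thesis using ij E_iff by blast
      qed
      with p(3) show "sum y (set ps) < block_weight t (card (set ps)) \<or> card (set ps) \<le> 3 \<and>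
          sum y (set ps) = block_weight t (card (set ps)) \<and> (\<forall>u\<in>set ps. \<forall>w\<in>set ps. u \<noteq> w \<longrightarrow> E u w)"
        unfolding sum_y card_C by auto
    qed (use ps(1) closed in auto)
  qed
qed

text \<open>Only one short block may remain, and it must be numbered last. If \<open>card W\<close>
  is a multiple of 3, C is numbered after W; otherwise C is empty or a triangle and comes first.
  Both shifts r and s are multiples of 3, so blocks inside each part are preserved.\<close>

lemma triangle_blocks_union:
  assumes fin: "finite C" "finite W" and disj: "C \<inter> W = {}"
    and full: "\<And>u w. u \<in> C \<Longrightarrow> w \<in> C \<Longrightarrow> u \<noteq> w \<Longrightarrow> E u w"
    and sep: "\<And>u w. u \<in> C \<Longrightarrow> w \<in> W \<Longrightarrow> \<not> E u w \<and> \<not> E w u"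
    and card: "card C \<le> 3" "card C mod 3 = 0 \<or> card W mod 3 = 0"
    and W: "triangle_blocks W E"
  shows "triangle_blocks (C \<union> W) E"
proof -
  obtain f where f: "bij_betw f W {..<card W}"
    and fE: "\<And>u w. u \<in> W \<Longrightarrow> w \<in> W \<Longrightarrow> u \<noteq> w \<Longrightarrow> E u w \<longleftrightarrow> f u div 3 = f w div 3"
    using W unfolding triangle_blocks_def by blast
  obtain h where h: "bij_betw h C {..<card C}"
    using ex_bij_betw_finite_nat[OF fin(1)] by (auto simp: atLeast0LessThan)
  define s where "s = (if card W mod 3 = 0 then 0 else card C)"
  define r where "r = (if card W mod 3 = 0 then card W else 0)"
  define g where "g u = (if u \<in> C then r + h u else s + f u)" for u
  have hC: "h u < card C" if "u \<in> C" for u using h that by (auto simp: bij_betw_def)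
  have fW: "f u < card W" if "u \<in> W" for u using f that by (auto simp: bij_betw_def)
  have gC: "g u = r + h u" if "u \<in> C" for u using that by (simp add: g_def)
  have gW: "g u = s + f u" if "u \<in> W" for u using that disj by (auto simp: g_def)
  have cardU: "card (C \<union> W) = card C + card W" using card_Un_disjoint fin disj by blast
  have r3: "r mod 3 = 0" and s3: "s mod 3 = 0" using card(2) by (auto simp: r_def s_def)
  have sepg: "g u div 3 \<noteq> g w div 3" if "u \<in> C" "w \<in> W" for u w
  proof (cases "card W mod 3 = 0")
    case True
    then obtain d where d: "card W = 3 * d" by (metis mod_0_imp_dvd dvdE)
    then show ?thesis using True fW[OF that(2)] that by (simp add: gC gW r_def s_def) 
  next
    case False
    have "0 < card C" using that(1) fin(1) by (auto simp: card_gt_0_iff)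
    with False card have "card C = 3" by presburger
    then show ?thesis using False hC[OF that(1)] that by (simp add: gC gW r_def s_def)
  qed
  have "inj_on g (C \<union> W)"
  proof (rule inj_onI)
    fix u w assume uw: "u \<in> C \<union> W" "w \<in> C \<union> W" "g u = g w"
    show "u = w"
    proof (cases "u \<in> C"; cases "w \<in> C")
      assume "u \<in> C" "w \<in> C"
      then show ?thesis using uw(3) h by (auto simp: gC bij_betw_def inj_on_def)
    next
      assume "u \<notin> C" "w \<notin> C"
      then show ?thesis using uw f by (auto simp: gW bij_betw_def inj_on_def)
    qed (use uw sepg in fastforce)+
  qed
  moreover have "g ` (C \<union> W) \<subseteq> {..<card (C \<union> W)}"
    using hC fW unfolding cardU by (fastforce simp: gC gW r_def s_def)
  ultimately have "bij_betw g (C \<union> W) {..<card (C \<union> W)}"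
    unfolding bij_betw_def using fin by (simp add: card_image card_subset_eq)
  moreover have "E u w \<longleftrightarrow> g u div 3 = g w div 3" if "u \<in> C \<union> W" "w \<in> C \<union> W" "u \<noteq> w" for u w
  proof (cases "u \<in> C"; cases "w \<in> C")
    assume uw: "u \<in> C" "w \<in> C"
    then have "h u < 3" "h w < 3" using hC card(1) by (meson less_le_trans)+
    moreover obtain d where "r = 3 * d" using r3 by (metis mod_0_imp_dvd dvdE)
    ultimately show ?thesis using uw full \<open>u \<noteq> w\<close> by (simp add: gC)
  next
    assume "u \<notin> C" "w \<notin> C"
    moreover obtain d where "s = 3 * d" using s3 by (metis mod_0_imp_dvd dvdE)
    ultimately show ?thesis using that fE by (simp add: gW)
  next
    assume "u \<in> C" "w \<notin> C"
    then show ?thesis using that sep sepg by auto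
  next
    assume "u \<notin> C" "w \<in> C"
    then show ?thesis using that sep sepg[of w u] by auto
  qed
  ultimately show ?thesis unfolding triangle_blocks_def by blast
qed

text \<open>Components are split off one at a time; their totals add and superadditivity bounds the
  sum. Equality forces equality in both pieces and at most one nonzero remainder mod 3, which is
  what merging the block numberings requires.\<close>

lemma extremal_weights:
  fixes W :: "'a set"
  assumes t: "t > 0" and fin: "finite W"
    and sym: "\<And>u w. E u w \<Longrightarrow> E w u" and irr: "\<And>u. \<not> E u u"
    and "\<And>u. u \<in> W \<Longrightarrow> card {w \<in> W. E u w} \<le> 2" and "no_long_cycle W E"
  shows "\<exists>y. weight_supersolution t W E y \<and>
    (sum y W < block_weight t (card W) \<or> sum y W = block_weight t (card W) \<and> triangle_blocks W E)"
  using fin assms(5,6)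
proof (induction W rule: finite_psubset_induct)
  case (psubset W)
  show ?case
  proof (cases "W = {}")
    case True
    then show ?thesis
      by (auto simp: weight_supersolution_def triangle_blocks_def block_weight_def bij_betw_def)
  next
    case False
    obtain C y where C: "C \<subseteq> W" "C \<noteq> {}" "\<forall>u\<in>C. \<forall>w\<in>W. E u w \<longrightarrow> w \<in> C"
      and y: "weight_supersolution t C E y"
      and sum_y: "sum y C < block_weight t (card C) \<or>
        card C \<le> 3 \<and> sum y C = block_weight t (card C) \<and> (\<forall>u\<in>C. \<forall>w\<in>C. u \<noteq> w \<longrightarrow> E u w)"
      by (rule extremal_component[where E = E, OF t psubset.hyps False sym irr psubset.prems])
    let ?U = "W - C"
    have "card {w \<in> ?U. E u w} \<le> 2" if "u \<in> ?U" for u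
      using psubset.prems(1)[of u] that psubset.hyps card_mono[of "{w \<in> W. E u w}" "{w \<in> ?U. E u w}"]
      by fastforce
    moreover have "no_long_cycle ?U E" using psubset.prems(2) by (auto simp: no_long_cycle_def)
    ultimately obtain z where z: "weight_supersolution t ?U E z"
      and sum_z: "sum z ?U < block_weight t (card ?U) \<or> sum z ?U = block_weight t (card ?U) \<and> triangle_blocks ?U E"
      using psubset.IH[of ?U] C(1,2) by blast
    have finC: "finite C" "finite ?U" using C(1) psubset.hyps finite_subset by auto
    have W: "W = C \<union> ?U" using C(1) by auto
    define x where "x u = (if u \<in> C then y u else z u)" for u
    \<comment> \<open>No edge joins C to the rest, so the rows of either piece survive in W.\<close>
    have NC: "{w \<in> W. E u w} = {w \<in> C. E u w}" if "u \<in> C" for u using that C by auto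
    have NU: "{w \<in> W. E u w} = {w \<in> ?U. E u w}" if "u \<in> ?U" for u using that C sym by blast
    have "weight_supersolution t W E x"
      unfolding weight_supersolution_def
    proof
      fix u assume "u \<in> W"
      show "0 < x u \<and> 1 + sum x {w \<in> W. E u w} \<le> (t + 4 - real (card {w \<in> W. E u w})) * x u"
      proof (cases "u \<in> C")
        case True
        have "sum x {w \<in> C. E u w} = sum y {w \<in> C. E u w}" by (rule sum.cong) (auto simp: x_def)
        then show ?thesis using y True unfolding weight_supersolution_def NC[OF True] by (simp add: x_def)
      next
        case False
        then have u: "u \<in> ?U" using \<open>u \<in> W\<close> by simp
        have "sum x {w \<in> ?U. E u w} = sum z {w \<in> ?U. E u w}" by (rule sum.cong) (auto simp: x_def)
        then show ?thesis using z u unfolding weight_supersolution_def NU[OF u] by (simp add: x_def)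
      qed
    qed
    moreover have "sum x W < block_weight t (card W) \<or> sum x W = block_weight t (card W) \<and> triangle_blocks W E"
    proof -
      have "sum x W = sum x C + sum x ?U"
        using C(1) psubset.hyps by (metis add.commute sum.subset_diff)
      moreover have "sum x C = sum y C" "sum x ?U = sum z ?U" by (auto simp: x_def intro!: sum.cong)
      ultimately have sum_x: "sum x W = sum y C + sum z ?U" by simp
      have cardW: "card W = card C + card ?U"
        using C(1) psubset.hyps by (metis card_Diff_subset card_mono finC(1) le_add_diff_inverse)
      note le = block_weight_superadditive[OF t, of "card C" "card ?U"]
      show ?thesis
      proof (cases "sum x W < block_weight t (card W)")
        case False
        then have eq: "card C \<le> 3" "\<forall>u\<in>C. \<forall>w\<in>C. u \<noteq> w \<longrightarrow> E u w" "triangle_blocks ?U E"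
          "sum x W = block_weight t (card W)"
          using sum_y sum_z le(1) unfolding sum_x cardW by auto
        have mod: "card C mod 3 = 0 \<or> card ?U mod 3 = 0"
          using False sum_y sum_z le(2) unfolding sum_x cardW by linarith
        have "triangle_blocks (C \<union> ?U) E"
        proof (rule triangle_blocks_union[OF finC _ _ _ eq(1) mod eq(3)])
          show "\<And>u w. u \<in> C \<Longrightarrow> w \<in> ?U \<Longrightarrow> \<not> E u w \<and> \<not> E w u" using C(3) sym by blast
        qed (use eq(2) in auto)
        with W eq(4) show ?thesis by simp
      qed simp
    qed
    ultimately show ?thesis by blast
  qed
qed

section \<open>The extremal graph\<close>

lemma verts_F: "verts (F_graph 2 3 n) = {0..<n}"
  by (simp add: verts_def F_graph_def)

lemma adj_F: "adj (F_graph 2 3 n) i j \<longleftrightarrow> i < n \<and> j < n \<and> i \<noteq> j \<and>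
    (i = 0 \<or> j = 0 \<or> (i - 1) div 3 = (j - 1) div 3)"
  by (auto simp: adj_def edges_def F_graph_def doubleton_eq_iff)

lemma card_block:
  fixes k m :: nat
  assumes "k < m"
  shows "card {j \<in> {..<m}. j div 3 = k div 3} = (if k < 3 * (m div 3) then 3 else m mod 3)"
proof (cases "k < 3 * (m div 3)")
  case True
  have "{j \<in> {..<m}. j div 3 = k div 3} = {3 * (k div 3)..<3 * (k div 3) + 3}"
  proof (rule Set.set_eqI)
    fix j
    have "k div 3 < m div 3" using True by linarith
    then have "j < m \<and> j div 3 = k div 3 \<longleftrightarrow> 3 * (k div 3) \<le> j \<and> j < 3 * (k div 3) + 3"
      by (intro iffI conjI; elim conjE; linarith)
    then show "j \<in> {j \<in> {..<m}. j div 3 = k div 3} \<longleftrightarrow> j \<in> {3 * (k div 3)..<3 * (k div 3) + 3}"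
      by simp
  qed
  then show ?thesis using True by simp
next
  case False
  have "{j \<in> {..<m}. j div 3 = k div 3} = {3 * (m div 3)..<m}"
  proof (rule Set.set_eqI)
    fix j
    have "k div 3 = m div 3" using False assms by linarith
    then have "j < m \<and> j div 3 = k div 3 \<longleftrightarrow> 3 * (m div 3) \<le> j \<and> j < m"
      by (intro iffI conjI; elim conjE; linarith)
    then show "j \<in> {j \<in> {..<m}. j div 3 = k div 3} \<longleftrightarrow> j \<in> {3 * (m div 3)..<m}"
      by simp
  qed
  then show ?thesis using False by (simp add: minus_mult_div_eq_mod)
qed

text \<open>A positive eigenvector is exhibited: 1 at the apex 0, and
  \<open>1 / (t + 6 - 2 * b)\<close> on a block of size b. The row of the apex is exactly the
  fixpoint equation for t.\<close>

lemma q_F_graph: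
  assumes t: "t > 0" "t + 5 = real (n - 1) + block_weight t (n - 1)" and "n > 0"
  shows "q (F_graph 2 3 n) = t + 5"
proof -
  let ?F = "F_graph 2 3 n"
  obtain m where n: "n = Suc m" using \<open>n > 0\<close> by (cases n) auto
  define B where "B k = {j \<in> {..<m}. j div 3 = k div 3}" for k
  define b where "b k = 1 / (t + 6 - 2 * real (card (B k)))" for k
  define y where "y i = (case i of 0 \<Rightarrow> 1 | Suc k \<Rightarrow> b k)" for i
  have y: "y 0 = 1" "y (Suc k) = b k" for k by (simp_all add: y_def)
  have cardB: "card (B k) = (if k < 3 * (m div 3) then 3 else m mod 3)" if "k < m" for k
    unfolding B_def using card_block[OF that] .
  have denom: "t + 6 - 2 * real (card (B k)) > 0" if "k < m" for k
  proof -
    have "card (B k) \<le> 3" unfolding cardB[OF that] using mod_less_divisor[of 3 m] by auto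
    then show ?thesis using t(1) by linarith
  qed
  have sum_b: "(\<Sum>k<m. b k) = block_weight t m"
  proof -
    have "{..<m} = {..<3 * (m div 3)} \<union> {3 * (m div 3)..<m}" by auto
    then have "(\<Sum>k<m. b k) = (\<Sum>k<3 * (m div 3). b k) + (\<Sum>k=3 * (m div 3)..<m. b k)"
      by (simp add: sum.union_disjoint[symmetric] ivl_disj_int)
    also have "(\<Sum>k<3 * (m div 3). b k) = (\<Sum>k<3 * (m div 3). 1 / t)"
      by (intro sum.cong refl) (auto simp: b_def cardB)
    also have "(\<Sum>k=3 * (m div 3)..<m. b k) = (\<Sum>k=3 * (m div 3)..<m. 1 / (t + 6 - 2 * real (m mod 3)))"
      by (intro sum.cong refl) (auto simp: b_def cardB)
    finally show ?thesis by (simp add: block_weight_def minus_mult_div_eq_mod)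
  qed
  show ?thesis
  proof (rule q_eq_of_positive_eigenvector[of ?F y])
    show "finite (verts ?F)" "verts ?F \<noteq> {}" by (auto simp: verts_F n)
    fix i assume "i \<in> verts ?F"
    then have i: "i < n" by (simp add: verts_F)
    show "0 < y i" using i denom by (cases i) (auto simp: y b_def n)
    show "signless_laplacian ?F y i = (t + 5) * y i"
    proof (cases i)
      case 0
      have "{w \<in> verts ?F. adj ?F i w} = Suc ` {..<m}"
        using 0 by (auto simp: verts_F adj_F n gr0_conv_Suc image_iff)
      then have "signless_laplacian ?F y i = (\<Sum>k<m. 1 + b k)"
        by (simp add: signless_laplacian_alt sum.reindex card_image 0 y)
      also have "\<dots> = t + 5" using t(2) by (simp add: sum.distrib sum_b n)
      finally show ?thesis by (simp add: 0 y)
    next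
      case (Suc k)
      have k: "k < m" using i Suc n by simp
      then have kB: "k \<in> B k" "finite (B k)" by (auto simp: B_def)
      have "{w \<in> verts ?F. adj ?F i w} = insert 0 (Suc ` (B k - {k}))"
      proof (rule Set.set_eqI)
        fix w
        show "w \<in> {w \<in> verts ?F. adj ?F i w} \<longleftrightarrow> w \<in> insert 0 (Suc ` (B k - {k}))"
          using k by (cases w) (auto simp: verts_F adj_F n Suc B_def)
      qed
      then have "signless_laplacian ?F y i = b k + 1 + (\<Sum>j\<in>B k - {k}. b k + b j)"
        using kB by (simp add: signless_laplacian_alt sum.reindex card_image Suc y distrib_right)
      also have "(\<Sum>j\<in>B k - {k}. b k + b j) = (\<Sum>j\<in>B k - {k}. 2 * b k)"
      proof (intro sum.cong refl)
        fix j assume "j \<in> B k - {k}"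
        then have "B j = B k" by (auto simp: B_def)
        then show "b k + b j = 2 * b k" by (simp add: b_def)
      qed
      also have "\<dots> = (real (card (B k)) - 1) * (2 * b k)"
        using kB card_gt_0_iff[of "B k"] by (auto simp: of_nat_diff Suc_leI)
      \<comment> \<open>Collecting the multiples of \<open>b k\<close> leaves (t + 6 - 2 |B k|)
        \<open>b k\<close> = 1, which is the choice of \<open>b k\<close>.\<close>
      also have "b k + 1 + \<dots> = (t + 5) * b k"
      proof -
        have "b k * (t + 6 - 2 * real (card (B k))) = 1" using denom[OF k] by (simp add: b_def)
        then show ?thesis by (simp add: algebra_simps)
      qed
      finally show ?thesis by (simp add: Suc y)
    qed
  qed
qed

text \<open>The cubic is the fixpoint equation at t = x - 5 multiplied by its denominators
  \<open>x - 5\<close> and \<open>x + 1 - 2 * r\<close>, both positive for x > 5 because r is at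
  most 2.\<close>

lemma cubic_factorization:
  fixes x :: real
  assumes "x > 5" "n > 0" and r: "r = real ((n - 1) mod 3)" and m: "m = real n"
  shows "x ^ 3 - (m + 2 * r + 3) * x ^ 2 + (8 * r + 3 * m + 2 * r * m - 8) * x
      + 14 * r + 4 * m - 8 * r * m - 2 * r ^ 2 - 4
    = (x - 5) * (x + 1 - 2 * r) * (x - real (n - 1) - block_weight (x - 5) (n - 1))"
proof -
  have r2: "r \<le> 2" using less_Suc_eq_le[of "(n - 1) mod 3" 2] by (simp add: r)
  have div: "3 * real ((n - 1) div 3) = m - 1 - r"
  proof -
    have "3 * real ((n - 1) div 3) = real (3 * ((n - 1) div 3))" by simp
    also have "\<dots> = real (n - 1 - (n - 1) mod 3)" by (simp only: minus_mod_eq_mult_div)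
    also have "\<dots> = real (n - 1) - r" unfolding r by (rule of_nat_diff) simp
    finally show ?thesis using assms(2) by (simp add: m)
  qed
  have "block_weight (x - 5) (n - 1) = (m - 1 - r) / (x - 5) + r / (x + 1 - 2 * r)"
    unfolding block_weight_def div r[symmetric] by simp
  moreover have "x - 5 \<noteq> 0" "x + 1 - 2 * r \<noteq> 0" using assms(1) r2 by auto
  moreover have "real (n - 1) = m - 1" using assms(2) by (simp add: m)
  ultimately show ?thesis
    by (simp add: divide_simps) (simp add: algebra_simps power2_eq_square power3_eq_cube)
qed

text \<open>Beyond t + 5 all three factors are positive, since the block weight does not increase
  with its parameter; so no root is larger.\<close>

lemma Max_cubic_roots:
  assumes t: "t > 0" "t + 5 = real (n - 1) + block_weight t (n - 1)" and "n > 0"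
    and r: "r = real ((n - 1) mod 3)" and m: "m = real n"
  shows "Max {x::real. x ^ 3 - (m + 2 * r + 3) * x ^ 2 + (8 * r + 3 * m + 2 * r * m - 8) * x
      + 14 * r + 4 * m - 8 * r * m - 2 * r ^ 2 - 4 = 0} = t + 5"
proof (rule Max_eqI)
  let ?P = "\<lambda>x::real. x ^ 3 - (m + 2 * r + 3) * x ^ 2 + (8 * r + 3 * m + 2 * r * m - 8) * x
      + 14 * r + 4 * m - 8 * r * m - 2 * r ^ 2 - 4"
  note fact = cubic_factorization[OF _ \<open>n > 0\<close> r m]
  have r2: "r \<le> 2" using less_Suc_eq_le[of "(n - 1) mod 3" 2] by (simp add: r)
  let ?p = "[:14 * r + 4 * m - 8 * r * m - 2 * r ^ 2 - 4, 8 * r + 3 * m + 2 * r * m - 8,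
    - (m + 2 * r + 3), 1:]"
  have P_eq: "?P x = poly ?p x" for x
    by (simp add: algebra_simps power2_eq_square power3_eq_cube)
  show "finite {x. ?P x = 0}"
    unfolding P_eq by (rule poly_roots_finite) simp
  show "t + 5 \<in> {x. ?P x = 0}"
  proof -
    have "t + 5 - real (n - 1) - block_weight t (n - 1) = 0" using t(2) by linarith
    then show ?thesis
      using fact[of "t + 5", unfolded add_diff_cancel_right'] t(1) by (simp only: mem_Collect_eq)
  qed
  fix x assume x: "x \<in> {x. ?P x = 0}"
  show "x \<le> t + 5"
  proof (rule ccontr)
    assume "\<not> ?thesis"
    then have gt: "x > t + 5" by simp
    have "block_weight (x - 5) (n - 1) \<le> block_weight t (n - 1)" using gt t(1) by (intro block_weight_antimono) auto
    then have "0 < x - real (n - 1) - block_weight (x - 5) (n - 1)" using gt t(2) by linarith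
    then have "0 < (x - 5) * (x + 1 - 2 * r) * (x - real (n - 1) - block_weight (x - 5) (n - 1))"
      using gt t(1) r2 by (intro mult_pos_pos) auto
    moreover have "5 < x" using gt t(1) by simp
    ultimately have "0 < ?P x" using fact by simp
    then show False using x by simp
  qed
qed

section \<open>Vertices of large degree\<close>

lemma degree_le: "finite (verts G) \<Longrightarrow> Defs.degree G v \<le> card (verts G - {v})"
  unfolding Defs.degree_def by (rule card_mono) (auto simp: adj_def)

text \<open>Double counting of walks of length 2 from u: those returning to u number
  \<open>degree G u\<close>, and at most 2 end at each other vertex.\<close>

lemma sum_neighbour_degrees_le:
  assumes fin: "finite (verts G)" and u: "u \<in> verts G"
    and common: "\<And>u w. u \<noteq> w \<Longrightarrow> card {x \<in> verts G. adj G u x \<and> adj G w x} \<le> 2"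
  shows "(\<Sum>w | w \<in> verts G \<and> adj G u w. Defs.degree G w)
    \<le> Defs.degree G u + 2 * (card (verts G) - 1)"
proof -
  let ?V = "verts G"
  let ?N = "{w \<in> ?V. adj G u w}"
  have "(\<Sum>w\<in>?N. Defs.degree G w) = (\<Sum>w\<in>?N. \<Sum>x\<in>?V. of_bool (adj G w x))"
    using fin by (simp add: Defs.degree_def Collect_conj_eq)
  also have "\<dots> = (\<Sum>x\<in>?V. \<Sum>w\<in>?N. of_bool (adj G w x))" by (rule sum.swap)
  also have "\<dots> = (\<Sum>x\<in>?V. card {w \<in> ?V. adj G u w \<and> adj G x w})"
    using fin by (intro sum.cong refl) (auto simp: adj_sym[of G _ _] Int_def conj_assoc intro!: arg_cong[of _ _ card])
  also have "\<dots> = Defs.degree G u + (\<Sum>x\<in>?V - {u}. card {w \<in> ?V. adj G u w \<and> adj G x w})"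
    using fin u by (subst sum.remove[of _ u]) (auto simp: Defs.degree_def)
  also have "\<dots> \<le> Defs.degree G u + (\<Sum>x\<in>?V - {u}. 2)"
    using common by (intro add_left_mono sum_mono) auto
  finally show ?thesis using fin u by simp
qed

lemma q_le_card_of_small_degrees:
  assumes fin: "finite (verts G)" and n: "card (verts G) = n" "n \<ge> 10"
    and common: "\<And>u w. u \<noteq> w \<Longrightarrow> card {x \<in> verts G. adj G u x \<and> adj G w x} \<le> 2"
    and deg: "\<And>v. v \<in> verts G \<Longrightarrow> Defs.degree G v \<le> n - 4"
  shows "q G \<le> real n"
\<comment> \<open>The maximum with 1 only serves to make isolated vertices positive. Elsewhere, with
  d the degree of u, the row asks for d^2 plus the neighbour degrees to be at most n d.\<close>
proof (rule q_le_of_rows[of G "\<lambda>v. max 1 (real (Defs.degree G v))"])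
  show "verts G \<noteq> {}" using n by auto
  fix u assume u: "u \<in> verts G"
  let ?N = "{w \<in> verts G. adj G u w}"
  let ?d = "Defs.degree G u"
  show "signless_laplacian G (\<lambda>v. max 1 (real (Defs.degree G v))) u \<le> real n * max 1 (real ?d)"
  proof (cases "?d = 0")
    case True
    then have "?N = {}" using fin by (simp add: Defs.degree_def)
    then show ?thesis by (simp only: signless_laplacian_alt) simp
  next
    case False
    have pos: "1 \<le> Defs.degree G w" if "w \<in> ?N" for w
    proof -
      have "u \<in> {x \<in> verts G. adj G w x}" using that u adj_sym[of G w u] by simp
      then show ?thesis using fin by (auto simp: Defs.degree_def Suc_le_eq card_gt_0_iff)
    qed
    have "signless_laplacian G (\<lambda>v. max 1 (real (Defs.degree G v))) u
        = (\<Sum>w\<in>?N. real ?d + real (Defs.degree G w))"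
      unfolding signless_laplacian_alt using pos False by (intro sum.cong refl) (auto simp: max_def)
    also have "\<dots> = real (?d * ?d + (\<Sum>w\<in>?N. Defs.degree G w))"
      by (simp add: sum.distrib Defs.degree_def)
    also have "\<dots> \<le> real (n * ?d)"
    proof (rule of_nat_mono)
      show "?d * ?d + (\<Sum>w\<in>?N. Defs.degree G w) \<le> n * ?d"
      \<comment> \<open>For d at most 4 the bound n - 4 on each neighbour degree suffices; for
        larger d the walk count is used.\<close>
      proof (cases "?d \<le> 4")
        case True
        have "(\<Sum>w\<in>?N. Defs.degree G w) \<le> (\<Sum>w\<in>?N. n - 4)" using deg by (intro sum_mono) auto
        also have "\<dots> = ?d * (n - 4)" by (simp add: Defs.degree_def)
        finally have "?d * ?d + (\<Sum>w\<in>?N. Defs.degree G w) \<le> ?d * (?d + (n - 4))"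
          by (simp add: distrib_left)
        also have "\<dots> \<le> ?d * n" using True n(2) by (intro mult_left_mono) auto
        finally show ?thesis by (simp add: mult.commute)
      next
        case False
        have "?d = 5 + (?d - 5)" using False by simp
        then obtain a where a: "?d = 5 + a" by blast
        have "n = ?d + 4 + (n - 4 - ?d)" using deg[OF u] n(2) by linarith
        then obtain c where c: "n = ?d + 4 + c" by blast
        have "(\<Sum>w\<in>?N. Defs.degree G w) \<le> ?d + 2 * (n - 1)"
          using sum_neighbour_degrees_le[OF fin u common] n(1) by simp
        moreover have "?d * ?d + (?d + 2 * (n - 1)) \<le> n * ?d"
        proof -
          \<comment> \<open>With d = 5 + a and n = d + 4 + c the claim reduces to this; it fails
            only for a = c = 0, that is n = 9.\<close>
          have "1 \<le> a + (a * c + c * 3)" using n(2) c a by (cases a; cases c) auto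
          then show ?thesis unfolding c unfolding a by (simp add: algebra_simps)
        qed
        ultimately show ?thesis by linarith
      qed
    qed
    finally show ?thesis using False by (simp add: max_def)
  qed
qed (use fin in auto)

text \<open>A vertex u other than v has at most 5 neighbours: v, at most 2 shared with v, and at
  most 2 among the non-neighbours of v. Its row is then at most 1 + 18 / n, which is where n >= 18
  enters; the row of v is at most (n - 2)(1 + 2 / n) < n.\<close>

lemma q_le_card_of_large_degree:
  assumes fin: "finite (verts G)" and n: "card (verts G) = n" "n \<ge> 18"
    and common: "\<And>u w. u \<noteq> w \<Longrightarrow> card {x \<in> verts G. adj G u x \<and> adj G w x} \<le> 2"
    and v: "v \<in> verts G" "n - 3 \<le> Defs.degree G v" "Defs.degree G v \<le> n - 2"
  shows "q G \<le> real n"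
proof (rule q_le_of_rows[of G "\<lambda>u. if u = v then 1 else 2 / real n"])
  let ?y = "\<lambda>u. if u = v then 1 else 2 / real n"
  show "verts G \<noteq> {}" using n by auto
  show "0 < ?y u" for u using n by auto
  fix u assume u: "u \<in> verts G"
  let ?N = "{w \<in> verts G. adj G u w}"
  show "signless_laplacian G ?y u \<le> real n * ?y u"
  proof (cases "u = v")
    case True
    have "signless_laplacian G ?y u = (\<Sum>w\<in>?N. 1 + 2 / real n)"
      unfolding signless_laplacian_alt using True by (intro sum.cong) (auto simp: adj_def)
    also have "\<dots> = real (Defs.degree G v) * (1 + 2 / real n)" by (simp add: Defs.degree_def True)
    also have "\<dots> \<le> (real n - 2) * (1 + 2 / real n)" using v(3) n(2) by (intro mult_right_mono) auto
    also have "\<dots> \<le> real n" using n(2) by (simp add: field_simps)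
    finally show ?thesis using True by simp
  next
    case False
    let ?M = "{w \<in> verts G. adj G v w}"
    have "card ?N \<le> card (insert v {x \<in> verts G. adj G u x \<and> adj G v x} \<union> (verts G - {v} - ?M))"
      using fin by (intro card_mono) auto
    also have "\<dots> \<le> card (insert v {x \<in> verts G. adj G u x \<and> adj G v x}) + card (verts G - {v} - ?M)"
      by (rule card_Un_le)
    also have "\<dots> \<le> 3 + 2"
    proof (rule add_mono)
      show "card (insert v {x \<in> verts G. adj G u x \<and> adj G v x}) \<le> 3"
        using common[OF False] card_insert_le_m1[of 3] fin by (simp add: card_insert_if)
      have "card (verts G - {v} - ?M) = n - 1 - Defs.degree G v"
        using fin v n by (subst card_Diff_subset) (auto simp: Defs.degree_def adj_def)
      then show "card (verts G - {v} - ?M) \<le> 2" using v(2) by linarith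
    qed
    finally have card: "card ?N \<le> 5" by simp
    have "signless_laplacian G ?y u = (\<Sum>w\<in>?N. 4 / real n + (if w = v then 1 - 2 / real n else 0))"
      unfolding signless_laplacian_alt using False by (intro sum.cong) auto
    also have "\<dots> = real (card ?N) * (4 / real n) + (if v \<in> ?N then 1 - 2 / real n else 0)"
      using fin by (simp add: sum.distrib)
    also have "\<dots> \<le> 5 * (4 / real n) + (1 - 2 / real n)"
      using card n(2) by (intro add_mono mult_right_mono) auto
    also have "\<dots> \<le> 2" using n(2) by (simp add: field_simps)
    finally show ?thesis using False n(2) by simp
  qed
qed (use fin in auto)

section \<open>A vertex adjacent to all others, and the conclusion\<close>

lemma isomorphic_F_graph:
  assumes fin: "finite (verts G)" and n: "card (verts G) = n" and v: "v \<in> verts G"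
    and apex: "\<And>w. w \<in> verts G \<Longrightarrow> w \<noteq> v \<Longrightarrow> adj G v w"
    and blocks: "triangle_blocks (verts G - {v}) (adj G)"
  shows "isomorphic G (F_graph 2 3 n)"
proof -
  let ?W = "verts G - {v}"
  have cardW: "card ?W = n - 1" using fin v n by simp
  have n0: "n > 0" using fin v n by (auto simp: card_gt_0_iff)
  obtain f where f: "bij_betw f ?W {..<n - 1}"
    and fE: "\<And>u w. u \<in> ?W \<Longrightarrow> w \<in> ?W \<Longrightarrow> u \<noteq> w \<Longrightarrow> adj G u w \<longleftrightarrow> f u div 3 = f w div 3"
    using blocks unfolding triangle_blocks_def cardW by blast
  define g where "g u = (if u = v then 0 else Suc (f u))" for u
  have fW: "f u < n - 1" if "u \<in> ?W" for u using f that by (auto simp: bij_betw_def)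
  have inj: "f u \<noteq> f w" if "u \<in> ?W" "w \<in> ?W" "u \<noteq> w" for u w
    using f that by (auto simp: bij_betw_def inj_on_def)
  have "inj_on g (verts G)" using inj by (auto simp: inj_on_def g_def)
  moreover have "g ` verts G \<subseteq> {0..<n}" using fW n0 by (fastforce simp: g_def)
  ultimately have "bij_betw g (verts G) {0..<n}"
    unfolding bij_betw_def using n by (simp add: card_image card_subset_eq)
  moreover have "adj G u w \<longleftrightarrow> adj (F_graph 2 3 n) (g u) (g w)" if uw: "u \<in> verts G" "w \<in> verts G" for u w
  proof (cases "u = w")
    case True
    then show ?thesis by (simp add: adj_def)
  next
    case False
    consider "u = v" | "w = v" | "u \<in> ?W" "w \<in> ?W" using uw by auto
    then show ?thesis
    proof cases
      case 1
      then show ?thesis using False uw apex fW n0 by (fastforce simp: adj_F g_def)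
    next
      case 2
      then show ?thesis using False uw apex[of u] adj_sym[of G u] fW n0 by (fastforce simp: adj_F g_def)
    next
      case 3
      then show ?thesis using False fE fW[of u] fW[of w] inj[of u w] by (auto simp: adj_F g_def)
    qed
  qed
  ultimately show ?thesis unfolding isomorphic_def verts_F by blast
qed

text \<open>Neighbours of u inside \<open>?W\<close> are common neighbours of u and v, so degrees
  there are at most 2; a cycle of length at least 4 in \<open>?W\<close> would be the rim of a wheel
  with hub v. The component weights then apply.\<close>

lemma apex_extremal:
  fixes G :: "'a graph"
  assumes G: "simple_graph G" and mf: "minor_free (K_bip 2 3) G"
    and n: "card (verts G) = n" "n \<ge> 2" and v: "v \<in> verts G" "Defs.degree G v = n - 1"
    and t: "t > 0" "t + 5 = real (n - 1) + block_weight t (n - 1)"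
  shows "q G < t + 5 \<or> isomorphic G (F_graph 2 3 n)"
proof -
  let ?W = "verts G - {v}"
  let ?N = "\<lambda>u. {w \<in> ?W. adj G u w}"
  have fin: "finite (verts G)" using G by (simp add: simple_graph_def)
  have cardW: "card ?W = n - 1" using fin v n by simp
  have "{w \<in> verts G. adj G v w} = ?W"
    using fin v cardW by (intro card_subset_eq) (auto simp: Defs.degree_def adj_def)
  then have Nv: "{w \<in> verts G. adj G v w} = ?W" and apex: "\<And>w. w \<in> ?W \<Longrightarrow> adj G v w" by auto
  have sym: "\<And>u w. adj G u w \<Longrightarrow> adj G w u" using adj_sym by metis
  have irr: "\<And>u. \<not> adj G u u" by (simp add: adj_def)
  have deg: "card (?N u) \<le> 2" if "u \<in> ?W" for u
  proof -
    have "card (?N u) \<le> card {x \<in> verts G. adj G u x \<and> adj G v x}"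
      using fin apex by (intro card_mono) auto
    also have "\<dots> \<le> 2" using that by (intro card_common_neighbours_le[OF G mf]) auto
    finally show ?thesis .
  qed
  have nlc: "no_long_cycle ?W (adj G)"
    unfolding no_long_cycle_def
  proof (intro allI impI notI)
    fix cs assume "set cs \<subseteq> ?W" "distinct cs" "4 \<le> length cs" "successively (adj G) cs"
      "adj G (last cs) (hd cs)"
    then have "is_minor (K_bip 2 3) G"
      using apex by (intro wheel_K23_minor[OF G, of cs v]) auto
    with mf show False by (simp add: minor_free_def)
  qed
  obtain y where y: "weight_supersolution t ?W (adj G) y"
    and sum_y: "sum y ?W < block_weight t (n - 1) \<or>
      sum y ?W = block_weight t (n - 1) \<and> triangle_blocks ?W (adj G)"
    using extremal_weights[OF t(1) finite_Diff[OF fin] sym irr deg nlc] unfolding cardW by blast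
  show ?thesis
  proof (cases "sum y ?W < block_weight t (n - 1)")
    case False
    then have "triangle_blocks ?W (adj G)" using sum_y by auto
    then have "isomorphic G (F_graph 2 3 n)"
      using apex by (intro isomorphic_F_graph[OF fin n(1) v(1)]) auto
    then show ?thesis ..
  next
    case True
    have ypos: "y u > 0" if "u \<in> ?W" for u using y that by (simp add: weight_supersolution_def)
    have "?W \<noteq> {}" using cardW n(2) by force
    then have S: "sum y ?W > 0" using ypos fin by (intro sum_pos) auto
    then have "1 < block_weight t (n - 1) / sum y ?W" using True by simp
    \<comment> \<open>Scaling the weights off v by c makes every row strict: off v the contribution
      1 of the apex stays unscaled, and at v the total remains below the block weight.\<close>
    then obtain c where c: "1 < c" "c < block_weight t (n - 1) / sum y ?W" using dense by blast
    let ?y = "\<lambda>u. if u = v then 1 else c * y u"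
    have "q G < t + 5"
    proof (rule q_less_of_rows[of G ?y])
      show "0 < ?y u" if "u \<in> verts G" for u using ypos that c(1) by auto
      fix u assume u: "u \<in> verts G"
      show "signless_laplacian G ?y u < (t + 5) * ?y u"
      proof (cases "u = v")
        case True
        have "signless_laplacian G ?y u = (\<Sum>w\<in>?W. 1 + c * y w)"
          unfolding signless_laplacian_alt using True Nv by (intro sum.cong) auto
        also have "\<dots> = real (n - 1) + c * sum y ?W"
          by (simp add: sum.distrib cardW sum_distrib_left)
        also have "\<dots> < t + 5" using c(2) S t(2) by (simp add: field_simps)
        finally show ?thesis using True by simp
      next
        case False
        then have uW: "u \<in> ?W" using u by simp
        let ?d = "real (card (?N u))"
        have row: "1 + sum y (?N u) \<le> (t + 4 - ?d) * y u"
          using y uW by (simp add: weight_supersolution_def)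
        have N: "{w \<in> verts G. adj G u w} = insert v (?N u)" using v(1) apex[OF uW] sym by auto
        have "signless_laplacian G ?y u = c * y u + 1 + (\<Sum>w\<in>?N u. c * y u + c * y w)"
          unfolding signless_laplacian_alt N using fin False
          by (subst sum.insert) (auto intro!: sum.cong)
        also have "\<dots> = c * y u + 1 + ?d * (c * y u) + c * sum y (?N u)"
          by (simp add: sum.distrib sum_distrib_left)
        also have "\<dots> < c * y u + ?d * (c * y u) + c * (1 + sum y (?N u))"
          using c(1) by (simp add: distrib_left)
        also have "\<dots> \<le> c * y u + ?d * (c * y u) + c * ((t + 4 - ?d) * y u)"
          using row c(1) by (intro add_left_mono mult_left_mono) auto
        also have "\<dots> = (t + 5) * (c * y u)" by (simp add: algebra_simps)
        finally show ?thesis using False by simp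
      qed
    qed (use fin v in auto)
    then show ?thesis ..
  qed
qed

theorem theorem1p2:
  fixes G :: "'a graph" and n :: nat
  assumes "simple_graph G"
    and "minor_free (K_bip 2 3) G"
    and "n = card (verts G)"
    and "n \<ge> 22"
  shows "q G \<le> q (F_graph 2 3 n)
    \<and> (q G = q (F_graph 2 3 n) \<longleftrightarrow> isomorphic G (F_graph 2 3 n))
    \<and> (let r = real ((n - 1) mod 3); m = real n in
        q (F_graph 2 3 n) = Max {x::real. x ^ 3 - (m + 2 * r + 3) * x ^ 2
            + (8 * r + 3 * m + 2 * r * m - 8) * x + 14 * r + 4 * m - 8 * r * m - 2 * r ^ 2 - 4 = 0})"
proof -
  have fin: "finite (verts G)" using assms(1) by (simp add: simple_graph_def)
  obtain t where t: "t > real n - 5" "t + 5 = real (n - 1) + block_weight t (n - 1)"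
    using block_weight_fixpoint[of n] assms(4) by auto
  have t0: "t > 0" and n0: "n > 0" using t(1) assms(4) by auto
  have qF: "q (F_graph 2 3 n) = t + 5" by (rule q_F_graph[OF t0 t(2) n0])
  note common = card_common_neighbours_le[OF assms(1,2)]
  \<comment> \<open>This settles bound and equality case together, as isomorphic graphs have equal
    q.\<close>
  have main: "q G < t + 5 \<or> isomorphic G (F_graph 2 3 n)"
  proof -
    have le: "Defs.degree G v \<le> n - 1" if "v \<in> verts G" for v
      using degree_le[OF fin, of v] that fin assms(3) by simp
    consider v where "v \<in> verts G" "Defs.degree G v = n - 1"
      | v where "v \<in> verts G" "n - 3 \<le> Defs.degree G v" "Defs.degree G v \<le> n - 2"
      | "\<And>v. v \<in> verts G \<Longrightarrow> Defs.degree G v \<le> n - 4"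
    proof (cases "\<exists>v\<in>verts G. n - 3 \<le> Defs.degree G v")
      case True
      then obtain v where v: "v \<in> verts G" "n - 3 \<le> Defs.degree G v" by blast
      then have "Defs.degree G v = n - 1 \<or> Defs.degree G v \<le> n - 2" using le by fastforce
      then show ?thesis using v that(1,2) by blast
    next
      case False
      have "Defs.degree G v \<le> n - 4" if "v \<in> verts G" for v
      proof -
        have "Defs.degree G v < n - 3" using False that by auto
        then show ?thesis by linarith
      qed
      then show ?thesis using that(3) by blast
    qed
    then show ?thesis
    proof cases
      case (1 v)
      show ?thesis
        using assms(4) by (intro apex_extremal[OF assms(1,2) assms(3)[symmetric] _ 1 t0 t(2)]) simp
    next
      case (2 v)
      have "q G \<le> real n"
        using q_le_card_of_large_degree[OF fin _ _ common 2] assms(3,4) by simp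
      \<comment> \<open>The choice of t gives n < t + 5.\<close>
      then show ?thesis using t(1) by linarith
    next
      case 3
      have "q G \<le> real n"
        using q_le_card_of_small_degrees[OF fin _ _ common 3] assms(3,4) by simp
      then show ?thesis using t(1) by linarith
    qed
  qed
  have iso: "q G = q (F_graph 2 3 n)" if "isomorphic G (F_graph 2 3 n)"
    using that by (rule isomorphic_q_eq)
  show ?thesis
    using main iso Max_cubic_roots[OF t0 t(2) n0 refl refl] unfolding qF Let_def by auto
qed

end
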